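(* Let $n\ge 2$, let $X_1,\dots,X_n$ be pairwise disjoint compact metric spaces, $\Omega=X_1\times\cdots\times X_n$, and let $S\subset\Omega$ be a compact good set which is not full, with $\Pi_iS=X_i$ for $i=1,\dots,n$. Suppose $S$ has a Borel measurable boundary $B$ with $B\cap X_i\ne\emptyset$ for each $i$, and let $F=F(S,B)$ be a full set associated to $S$. Suppose that any two points of $F$ are related (in $F$) and that the lengths of geodesics in $F$ are bounded above. Then $C(X_1)+C(X_2)+\cdots+C(X_n)$ is dense in $C(S)$, and in fact $$C(X_1)+C(X_2)+\cdots+C(X_n)=C(S).$$
   Context: $\Pi_i:\Omega\to X_i$ denotes the canonical projection. $C(Y)$ is the space of continuous functions on $Y$ with the supremum norm, and $C(X_1)+\cdots+C(X_n)$ denotes the set of functions on $S$ of the form $(x_1,\dots,x_n)\mapsto u_1(x_1)+\cdots+u_n(x_n)$ with $u_i\in C(X_i)$. A subset $S\subset\Omega$ is good if every complex valued function $f$ on $S$ is of the form $f(x_1,\dots,x_n)=u_1(x_1)+\cdots+u_n(x_n)$ for all $(x_1,\dots,x_n)\in S$, for suitable complex functions $u_i$ on $X_i$. A subset $S\subset\Omega$ is full if $S$ is good and is not contained in a strictly larger good subset of $\Pi_1S\times\cdots\times\Pi_nS$. A subset $B\subset\bigcup_{i=1}^n\Pi_iS$ is a boundary (set) for a good set $S$ if for any complex valued function $U$ on $B$ and any $f:S\to\mathbb C$ the equation $u_1(x_1)+\cdots+u_n(x_n)=f(x_1,\dots,x_n)$, $(x_1,\dots,x_n)\in S$, subject to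 $u_i|_{B\cap\Pi_iS}=U|_{B\cap\Pi_iS}$, $1\le i\le n$, admits a unique solution (uniqueness meaning that the functions $u_i|_{\Pi_iS}$ are uniquely determined). $B$ is Borel measurable if each $B\cap X_i$ is a Borel subset of $X_i$. For a good set $S$ that is not full and a boundary $B$ of $S$ with $B_i=B\cap X_i\neq\emptyset$ for every $i$, choose $b_i\in B_i$ for each $i$ and put $R=\bigcup_{i=1}^n\{b_1\}\times\cdots\times\{b_{i-1}\}\times B_i\times\{b_{i+1}\}\times\cdots\times\{b_n\}$; the set $F(S,B)=S\cup R$ (which is full) is called a full set associated to $S$. Two points $\vec x,\vec y$ of a good set $G$ are related (in $G$) if some finite full subset of $G$ contains both. A finite full subset of $G$ containing $\vec x$ and $\vec y$ is a path joining them; its length is its cardinality; a path of smallest cardinality joining them is a geodesic. *)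

theory Defs
  imports "HOL-Analysis.Analysis"
begin

text \<open>
  The coordinates are indexed by a finite type \<open>'n\<close>, so the number of factors is \<open>CARD('n)\<close>.
  The pairwise disjoint compact metric spaces are compact subsets \<open>X i\<close> of one metric type
  \<open>'a\<close>; finitely many disjoint compact metric spaces always occur this way, isometrically, inside
  their disjoint union (put points of different spaces at one fixed positive distance that is at least
  every diameter). The topology of \<open>'a ^ 'n\<close> is the product topology.
\<close>

definition Omega :: "('n \<Rightarrow> 'a set) \<Rightarrow> ('a ^ 'n::finite) set" where
  "Omega X = {x. \<forall>i. x $ i \<in> X i}"

definition Proj :: "'n \<Rightarrow> ('a ^ 'n::finite) set \<Rightarrow> 'a set" where
  "Proj i S = (\<lambda>x. x $ i) ` S"

text \<open>
  In \<open>solves\<close>, \<open>good\<close> and \<open>boundary_of\<close>, functions on \<open>S\<close>, on a factor, or on \<open>B\<close> are total functions of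
  which only the values on that set are used.
\<close>

definition solves :: "('a ^ 'n::finite) set \<Rightarrow> ('a ^ 'n \<Rightarrow> complex) \<Rightarrow> ('n \<Rightarrow> 'a \<Rightarrow> complex) \<Rightarrow> bool" where
  "solves S f u \<longleftrightarrow> (\<forall>x\<in>S. (\<Sum>i\<in>UNIV. u i (x $ i)) = f x)"

definition good :: "('a ^ 'n::finite) set \<Rightarrow> bool" where
  "good S \<longleftrightarrow> (\<forall>f. \<exists>u. solves S f u)"

definition full :: "('a ^ 'n::finite) set \<Rightarrow> bool" where
  "full S \<longleftrightarrow> good S \<and> \<not> (\<exists>T. good T \<and> S \<subset> T \<and> T \<subseteq> Omega (\<lambda>i. Proj i S))"

definition boundary_of :: "('a ^ 'n::finite) set \<Rightarrow> 'a set \<Rightarrow> bool" where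
  "boundary_of S B \<longleftrightarrow>
     B \<subseteq> (\<Union>i. Proj i S) \<and>
     (\<forall>U f.
        (\<exists>u. solves S f u \<and> (\<forall>i. \<forall>a \<in> B \<inter> Proj i S. u i a = U a)) \<and>
        (\<forall>u v. solves S f u \<and> (\<forall>i. \<forall>a \<in> B \<inter> Proj i S. u i a = U a) \<and>
               solves S f v \<and> (\<forall>i. \<forall>a \<in> B \<inter> Proj i S. v i a = U a) \<longrightarrow>
               (\<forall>i. \<forall>a \<in> Proj i S. u i a = v i a)))"

definition borel_in :: "('n \<Rightarrow> 'a::topological_space set) \<Rightarrow> 'a set \<Rightarrow> bool" where
  "borel_in X B \<longleftrightarrow> (\<forall>i. B \<inter> X i \<in> sets (restrict_space borel (X i)))"

definition full_set_assoc ::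
    "('n \<Rightarrow> 'a set) \<Rightarrow> ('a ^ 'n::finite) set \<Rightarrow> 'a set \<Rightarrow> ('n \<Rightarrow> 'a) \<Rightarrow> ('a ^ 'n) set" where
  "full_set_assoc X S B b =
     S \<union> (\<Union>i. {x. x $ i \<in> B \<inter> X i \<and> (\<forall>j. j \<noteq> i \<longrightarrow> x $ j = b j)})"

definition is_full_set_assoc ::
    "('n \<Rightarrow> 'a set) \<Rightarrow> ('a ^ 'n::finite) set \<Rightarrow> 'a set \<Rightarrow> ('a ^ 'n) set \<Rightarrow> bool" where
  "is_full_set_assoc X S B F \<longleftrightarrow>
     (\<exists>b. (\<forall>i. b i \<in> B \<inter> X i) \<and> F = full_set_assoc X S B b)"

definition is_path :: "('a ^ 'n::finite) set \<Rightarrow> 'a ^ 'n \<Rightarrow> 'a ^ 'n \<Rightarrow> ('a ^ 'n) set \<Rightarrow> bool" where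
  "is_path G x y P \<longleftrightarrow> finite P \<and> full P \<and> P \<subseteq> G \<and> x \<in> P \<and> y \<in> P"

definition related :: "('a ^ 'n::finite) set \<Rightarrow> 'a ^ 'n \<Rightarrow> 'a ^ 'n \<Rightarrow> bool" where
  "related G x y \<longleftrightarrow> (\<exists>P. is_path G x y P)"

definition geodesic :: "('a ^ 'n::finite) set \<Rightarrow> 'a ^ 'n \<Rightarrow> 'a ^ 'n \<Rightarrow> ('a ^ 'n) set \<Rightarrow> bool" where
  "geodesic G x y P \<longleftrightarrow> is_path G x y P \<and> (\<forall>Q. is_path G x y Q \<longrightarrow> card P \<le> card Q)"

text \<open>
  The space of continuous complex functions on \<open>Y\<close> with the supremum metric; its elements are
  \<^const>\<open>extensional\<close> on \<open>Y\<close>, so that equal functions on \<open>Y\<close> are equal elements. The boundedness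
  built into \<^const>\<open>cfunspace\<close> is automatic for compact \<open>Y\<close>.
\<close>

abbreviation C_metric :: "'b::topological_space set \<Rightarrow> ('b \<Rightarrow> complex) metric" where
  "C_metric Y \<equiv> cfunspace (top_of_set Y) euclidean_metric"

abbreviation C :: "'b::topological_space set \<Rightarrow> ('b \<Rightarrow> complex) set" where
  "C Y \<equiv> mspace (C_metric Y)"

definition C_sum ::
    "('n \<Rightarrow> 'a::topological_space set) \<Rightarrow> ('a ^ 'n::finite) set \<Rightarrow> ('a ^ 'n \<Rightarrow> complex) set" where
  "C_sum X S = {restrict (\<lambda>x. \<Sum>i\<in>UNIV. u i (x $ i)) S | u. \<forall>i. u i \<in> C (X i)}"

end

theory Submission
  imports Defs
begin

text \<open>
  Every continuous \<open>f\<close> on \<open>S\<close> has a solution \<open>u\<close> that vanishes on the boundary \<open>B\<close>. The point is to show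
  that \<open>u\<close>, a priori a wild function, is bounded by a constant multiple of the supremum of \<open>f\<close> and has
  continuous restrictions to sets that a given positive functional regards as almost full. A
  Lusin-type argument then replaces \<open>u\<close> by continuous functions.

  Fix the point \<open>b\<close> that was used to build \<open>F\<close>. On a finite full set every solution of the homogeneous
  equation is constant in each coordinate (\<open>full_kernel_constant\<close>). So if \<open>P \<subseteq> F\<close> is a path from \<open>b\<close> to
  \<open>x\<close>, linear algebra writes \<open>u i (x $ i) - u i (b i)\<close> as a combination of the values of
  \<open>\<Sum>j. u j (p $ j)\<close> at the points \<open>p\<close> of \<open>P\<close>; these values are \<open>f p\<close> for \<open>p \<in> S\<close> and \<open>0\<close> for the points
  of \<open>F\<close> all of whose coordinates lie in \<open>B\<close>. The coefficients depend only on which coordinates of the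
  points of \<open>P\<close> coincide (\<open>path_pattern\<close>), and bounded geodesics leave finitely many such patterns. This
  bounds \<open>u\<close> (\<open>solution_bounded_on_reach\<close>). For a compact \<open>K \<subseteq> B\<close>, the configurations of points that
  have the coincidences of such a path and use only boundary values in \<open>K\<close> form a compact set, on
  which \<open>u i (x $ i)\<close> is given by finitely many continuous formulas; hence \<open>u i\<close> is continuous on the
  \<open>i\<close>-th projection of the set \<open>reach K\<close> of endpoints of these configurations
  (\<open>solution_continuous_on_reach\<close>).

  If \<open>f\<close> could not be uniformly approximated by sums of continuous functions within fixed bounds, then
  a separation argument would give a positive normalised functional \<open>\<psi>\<close> on the continuous functions on
  \<open>S\<close> such that \<open>\<psi>\<close> of the modulus of the error stays above some \<open>\<epsilon>\<close> for all such sums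
  (\<open>small_of_small_in_means\<close>). The outer measure of \<open>\<psi>\<close>, evaluated at \<open>reach E\<close>, is a Choquet capacity
  in \<open>E\<close>; as \<open>B\<close> is Borel and \<open>reach B = S\<close>, some compact \<open>K \<subseteq> B\<close> has \<open>reach K\<close> of almost full measure
  (\<open>capacitable_borel\<close>). Tietze extensions of the \<open>u i\<close> from the projections of \<open>reach K\<close> produce an
  error that vanishes on \<open>reach K\<close> and is bounded, so \<open>\<psi>\<close> of it is small after all. The bounds on the
  approximants are proportional to the supremum of \<open>f\<close>, so that correcting the error repeatedly
  gives a convergent series, and \<open>f\<close> itself is a sum of continuous functions
  (\<open>exact_of_approximate_sums\<close>).
\<close>

section \<open>Capacitability of Borel sets\<close>

lemma decseq_compact_Inter_nonempty:
  fixes K :: "nat \<Rightarrow> 'b::t2_space set"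
  assumes "\<And>n. compact (K n)" "\<And>n. K n \<noteq> {}" "decseq K"
  shows "(\<Inter>n. K n) \<noteq> {}"
proof -
  have fip: "K 0 \<inter> (\<Inter>n\<in>I. K n) \<noteq> {}" if "finite I" for I
  proof -
    have "K (Max (insert 0 I)) \<subseteq> K n" if "n \<in> insert 0 I" for n
      using \<open>decseq K\<close> \<open>finite I\<close> that by (simp add: decseqD)
    then have "K (Max (insert 0 I)) \<subseteq> K 0 \<inter> (\<Inter>n\<in>I. K n)"
      by blast
    then show ?thesis
      using assms(2)[of "Max (insert 0 I)"] by blast
  qed
  have "K 0 \<inter> (\<Inter>n\<in>UNIV. K n) \<noteq> {}"
    by (rule compact_imp_fip_image[OF assms(1) compact_imp_closed[OF assms(1)] fip])
  then show ?thesis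
    by blast
qed

text \<open>
  Projections of closed subsets of \<open>'a \<times> (nat \<Rightarrow> nat)\<close>: the Souslin sets of a metric space, in a
  form in which they are closed under countable unions and intersections by re-indexing the second component.
\<close>
definition souslin :: "'a::metric_space set \<Rightarrow> bool" where
  "souslin A \<longleftrightarrow> (\<exists>G :: ('a \<times> (nat \<Rightarrow> nat)) set. closed G \<and> A = fst ` G)"

lemma souslin_closed: "closed A \<Longrightarrow> souslin A"
  unfolding souslin_def by (intro exI[of _ "A \<times> UNIV"]) (auto simp: closed_Times)

lemma closed_vimage_Pair_snd:
  fixes G :: "('a::topological_space \<times> (nat \<Rightarrow> 'c::topological_space)) set" and \<pi> :: "nat \<Rightarrow> nat"
  assumes "closed G"
  shows "closed {z. (fst z, \<lambda>i. snd z (\<pi> i)) \<in> G}"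
proof -
  have "continuous_on UNIV (\<lambda>z::'a \<times> (nat \<Rightarrow> 'c). snd z j)" for j
    by (rule continuous_on_product_then_coordinatewise) (rule continuous_on_snd, rule continuous_on_id)
  then have "continuous_on UNIV (\<lambda>z::'a \<times> (nat \<Rightarrow> 'c). (fst z, \<lambda>i. snd z (\<pi> i)))"
    by (intro continuous_on_Pair continuous_on_fst continuous_on_id
        continuous_on_coordinatewise_then_product)
  from closed_vimage[OF assms this] show ?thesis
    by (simp add: vimage_def)
qed

lemma closed_snd_coordinate:
  "closed {z :: 'a::topological_space \<times> (nat \<Rightarrow> nat). P (snd z i)}"
proof -
  have "continuous_on UNIV (\<lambda>z::'a \<times> (nat \<Rightarrow> nat). snd z i)"
    by (rule continuous_on_product_then_coordinatewise) (rule continuous_on_snd, rule continuous_on_id)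
  moreover have "closed {m::nat. P m}"
    unfolding closed_def by (rule open_discrete)
  ultimately have "closed ((\<lambda>z::'a \<times> (nat \<Rightarrow> nat). snd z i) -` {m. P m})"
    by (intro closed_vimage)
  then show ?thesis
    by (simp add: vimage_def)
qed

text \<open>
  The first entry of the sequence can name the member of the union.
\<close>
lemma souslin_Union:
  fixes A :: "nat \<Rightarrow> 'a::metric_space set"
  assumes "\<And>m. souslin (A m)"
  shows "souslin (\<Union>m. A m)"
proof -
  have "\<forall>m. \<exists>G :: ('a \<times> (nat \<Rightarrow> nat)) set. closed G \<and> A m = fst ` G"
    using assms unfolding souslin_def by simp
  from choice[OF this] obtain G :: "nat \<Rightarrow> ('a \<times> (nat \<Rightarrow> nat)) set"
    where "\<forall>m. closed (G m) \<and> A m = fst ` G m" ..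
  then have G: "\<And>m. closed (G m)" "\<And>m. A m = fst ` G m"
    by simp_all
  define H where "H = {z. (fst z, \<lambda>i. snd z (Suc i)) \<in> G (snd z 0)}"
  have "H = (\<Inter>m. {z. snd z 0 \<noteq> m} \<union> {z. (fst z, \<lambda>i. snd z (Suc i)) \<in> G m})"
    by (auto simp: H_def)
  moreover have "closed \<dots>"
    by (intro closed_INT ballI closed_Un closed_vimage_Pair_snd G closed_snd_coordinate)
  ultimately have "closed H"
    by simp
  moreover have "(\<Union>m. A m) = fst ` H"
  proof (intro set_eqI iffI)
    fix x assume "x \<in> (\<Union>m. A m)"
    then obtain m s where "(x, s) \<in> G m"
      using G by auto
    then have "(x, case_nat m s) \<in> H"
      by (simp add: H_def)
    then have "fst (x, case_nat m s) \<in> fst ` H"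
      by (rule imageI)
    then show "x \<in> fst ` H"
      by simp
  next
    fix x assume "x \<in> fst ` H"
    then obtain z where "z \<in> H" "x = fst z"
      by blast
    then have "fst (x, \<lambda>i. snd z (Suc i)) \<in> fst ` G (snd z 0)"
      unfolding H_def by (intro imageI) simp
    then show "x \<in> (\<Union>m. A m)"
      using G by auto
  qed
  ultimately show ?thesis
    unfolding souslin_def by blast
qed

text \<open>
  One sequence can encode countably many, one for each member of the intersection.
\<close>
lemma souslin_Inter:
  fixes A :: "nat \<Rightarrow> 'a::metric_space set"
  assumes "\<And>m. souslin (A m)"
  shows "souslin (\<Inter>m. A m)"
proof -
  have "\<forall>m. \<exists>G :: ('a \<times> (nat \<Rightarrow> nat)) set. closed G \<and> A m = fst ` G"
    using assms unfolding souslin_def by simp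
  from choice[OF this] obtain G :: "nat \<Rightarrow> ('a \<times> (nat \<Rightarrow> nat)) set"
    where "\<forall>m. closed (G m) \<and> A m = fst ` G m" ..
  then have G: "\<And>m. closed (G m)" "\<And>m. A m = fst ` G m"
    by simp_all
  define H where "H = (\<Inter>m. {z. (fst z, \<lambda>i. snd z (prod_encode (m, i))) \<in> G m})"
  have "closed H"
    unfolding H_def by (intro closed_INT ballI closed_vimage_Pair_snd G)
  moreover have "(\<Inter>m. A m) = fst ` H"
  proof (intro set_eqI iffI)
    fix x assume "x \<in> (\<Inter>m. A m)"
    then have "x \<in> fst ` G m" for m
      using G(2) by blast
    then have "\<forall>m. \<exists>s. (x, s) \<in> G m"
      by force
    from choice[OF this] obtain s where s: "\<And>m. (x, s m) \<in> G m"
      by blast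
    then have "(x, \<lambda>j. case prod_decode j of (m, i) \<Rightarrow> s m i) \<in> H" (is "?z \<in> H")
      by (simp add: H_def)
    then have "fst ?z \<in> fst ` H"
      by (rule imageI)
    then show "x \<in> fst ` H"
      by simp
  next
    fix x assume "x \<in> fst ` H"
    then obtain z where z: "z \<in> H" "x = fst z"
      by blast
    have "fst (x, \<lambda>i. snd z (prod_encode (m, i))) \<in> fst ` G m" for m
      using z unfolding H_def by (intro imageI) simp
    then show "x \<in> (\<Inter>m. A m)"
      using G by auto
  qed
  ultimately show ?thesis
    unfolding souslin_def by blast
qed

text \<open>
  The class of sets that are Souslin together with their complement is a \<open>\<sigma>\<close>-algebra, and it contains
  the closed sets, because an open set in a metric space is a countable union of closed sets.
\<close>
lemma souslin_borel:
  fixes B :: "'a::metric_space set"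
  assumes "B \<in> sets borel"
  shows "souslin B"
proof -
  have "B \<in> sigma_sets UNIV {A. closed A}"
    using assms by (simp add: borel_eq_closed)
  then have "souslin B \<and> souslin (- B)"
  proof induction
    case (Basic A)
    have "souslin (- A)"
    proof (cases "A = {}")
      case False
      have "- A = (\<Union>k::nat. {x. inverse (real (Suc k)) \<le> infdist x A})"
      proof (intro set_eqI iffI)
        fix x assume "x \<in> - A"
        then have "0 < infdist x A"
          using Basic False infdist_pos_not_in_closed by auto
        then show "x \<in> (\<Union>k::nat. {x. inverse (real (Suc k)) \<le> infdist x A})"
          using reals_Archimedean[of "infdist x A"] by (auto intro: less_imp_le)
      next
        fix x assume "x \<in> (\<Union>k::nat. {x. inverse (real (Suc k)) \<le> infdist x A})"
        then obtain k where "inverse (real (Suc k)) \<le> infdist x A"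
          by auto
        moreover have "0 < inverse (real (Suc k))"
          by simp
        ultimately have "infdist x A \<noteq> 0"
          by linarith
        then show "x \<in> - A"
          using infdist_zero by auto
      qed
      moreover have "closed {x. inverse (real (Suc k)) \<le> infdist x A}" for k
        by (intro closed_Collect_le continuous_intros)
      ultimately show ?thesis
        by (metis (no_types, lifting) souslin_Union souslin_closed)
    qed (simp add: souslin_closed)
    with Basic show ?case
      by (simp add: souslin_closed)
  next
    case Empty
    then show ?case
      by (simp add: souslin_closed)
  next
    case (Compl A)
    then show ?case
      by (simp add: Compl_eq_Diff_UNIV[symmetric])
  next
    case (Union A)
    then show ?case
      by (simp add: souslin_Union souslin_Inter)
  qed
  then show ?thesis ..
qed

text \<open>
  Choquet's capacitability theorem. Let \<open>B\<close> be the projection of the closed set \<open>G\<close>. Continuity along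
  increasing sequences allows to bound the entries of the sequences in \<open>G\<close> one after the other, by
  \<open>m 0\<close>, \<open>m 1\<close> and so on, while the capacity of the projection stays above \<open>r\<close>. The closures of these
  projections decrease to a compact set. A point of it is a limit of points whose sequences are
  bounded on longer and longer initial segments; since the sequences bounded by \<open>m\<close> form a compact
  set, the limit is in the projection of \<open>G\<close>, which is \<open>B\<close>.
\<close>
lemma capacitable_borel:
  fixes c :: "'a::metric_space set \<Rightarrow> real"
  assumes "B \<in> sets borel" "B \<subseteq> Y" "compact Y" "r < c B"
    and mono: "\<And>E E'. E \<subseteq> E' \<Longrightarrow> c E \<le> c E'"
    and up: "\<And>E::nat \<Rightarrow> 'a set. incseq E \<Longrightarrow> r < c (\<Union>n. E n) \<Longrightarrow> \<exists>n. r < c (E n)"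
    and down: "\<And>K::nat \<Rightarrow> 'a set. decseq K \<Longrightarrow> (\<And>n. compact (K n)) \<Longrightarrow> (\<And>n. r \<le> c (K n))
       \<Longrightarrow> r \<le> c (\<Inter>n. K n)"
  shows "\<exists>K\<subseteq>B. compact K \<and> r \<le> c K"
proof -
  obtain G :: "('a \<times> (nat \<Rightarrow> nat)) set" where G: "closed G" "B = fst ` G"
    using souslin_borel[OF assms(1)] unfolding souslin_def by blast
  define H where "H m n = fst ` {z \<in> G. \<forall>i<n. snd z i \<le> m i}" for m :: "nat \<Rightarrow> nat" and n :: nat
  have "\<exists>f. \<forall>n. r < c (H (f n) n) \<and> (\<forall>i<n. f (Suc n) i = f n i)"
  proof (rule dependent_nat_choice)
    show "\<exists>m. r < c (H m 0)"
      using assms(4) G by (simp add: H_def)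
  next
    fix m n assume *: "r < c (H m n)"
    have H_Suc: "H (m(n := v)) (Suc n) = fst ` {z \<in> G. (\<forall>i<n. snd z i \<le> m i) \<and> snd z n \<le> v}" for v
      unfolding H_def by (rule arg_cong[where f = "image fst"]) (auto simp: less_Suc_eq)
    have "incseq (\<lambda>v. H (m(n := v)) (Suc n))"
      unfolding incseq_def H_Suc by (intro allI impI image_mono) auto
    moreover have "(\<Union>v. H (m(n := v)) (Suc n)) = H m n"
      unfolding H_Suc unfolding H_def by blast
    ultimately obtain v where "r < c (H (m(n := v)) (Suc n))"
      using up[of "\<lambda>v. H (m(n := v)) (Suc n)"] * by auto
    then show "\<exists>m'::nat \<Rightarrow> nat. r < c (H m' (Suc n)) \<and> (\<forall>i<n. m' i = m i)"
      by (intro exI[of _ "m(n := v)"]) auto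
  qed
  then obtain f where f: "\<And>n. r < c (H (f n) n)" "\<And>n i. i < n \<Longrightarrow> f (Suc n) i = f n i"
    by blast
  define m where "m i = f (Suc i) i" for i
  have m: "f n i = m i" if "i < n" for n i
    using that unfolding m_def by (induction n) (auto simp: less_Suc_eq f)
  have Hm: "H (f n) n = H m n" for n
    unfolding H_def by (simp add: m cong: conj_cong)
  have HB: "H m n \<subseteq> B" for n
    unfolding H_def G by auto
  define K where "K n = closure (H m n)" for n
  have "K n \<subseteq> Y" for n
    unfolding K_def using HB assms(2,3) by (metis closure_minimal compact_imp_closed order_trans)
  then have K: "compact (K n)" for n
    unfolding K_def using assms(3) by (metis closed_closure compact_Int_closed inf.absorb_iff2)
  have "H m (Suc n) \<subseteq> H m n" for n
    unfolding H_def by auto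
  then have "decseq K"
    unfolding K_def by (intro decseq_SucI closure_mono)
  have "r \<le> c (\<Inter>n. K n)"
  proof (rule down)
    fix n
    have "c (H m n) \<le> c (K n)"
      unfolding K_def by (intro mono closure_subset)
    then show "r \<le> c (K n)"
      using f(1)[of n] by (simp add: Hm)
  qed fact+
  moreover have "compact (\<Inter>n. K n)"
  proof -
    have "closed (\<Inter>n. K n)"
      using K by (intro closed_INT ballI compact_imp_closed)
    moreover have "(\<Inter>n. K n) \<subseteq> K 0"
      by blast
    ultimately show ?thesis
      using compact_Int_closed[OF K[of 0], of "\<Inter>n. K n"] by (simp add: inf.absorb2)
  qed
  moreover have "(\<Inter>n. K n) \<subseteq> B"
  proof
    fix x assume x: "x \<in> (\<Inter>n. K n)"
    have "\<exists>z. z \<in> G \<and> (\<forall>i<n. snd z i \<le> m i) \<and> dist (fst z) x < inverse (real (Suc n))" for n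
    proof -
      have "x \<in> closure (H m n)"
        using x by (auto simp: K_def)
      moreover have "0 < inverse (real (Suc n))"
        by simp
      ultimately obtain y where "y \<in> H m n" "dist y x < inverse (real (Suc n))"
        unfolding closure_approachable by blast
      then obtain z where "z \<in> G" "\<forall>i<n. snd z i \<le> m i" "y = fst z"
        unfolding H_def by blast
      then show ?thesis
        using \<open>dist y x < _\<close> by blast
    qed
    then have "\<forall>n. \<exists>z. z \<in> G \<and> (\<forall>i<n. snd z i \<le> m i) \<and> dist (fst z) x < inverse (real (Suc n))"
      by blast
    from choice[OF this] obtain z where
      "\<forall>n. z n \<in> G \<and> (\<forall>i<n. snd (z n) i \<le> m i) \<and> dist (fst (z n)) x < inverse (real (Suc n))" ..
    then have z: "\<And>n. z n \<in> G" "\<And>n i. i < n \<Longrightarrow> snd (z n) i \<le> m i"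
      "\<And>n. dist (fst (z n)) x < inverse (real (Suc n))"
      by simp_all
    \<comment> \<open>truncation makes the sequences lie in a compact product and changes none of the first n entries\<close>
    define s where "s n i = min (snd (z n) i) (m i)" for n i
    have "compactin (product_topology (\<lambda>i. euclidean :: nat topology) UNIV) (PiE UNIV (\<lambda>i. {..m i}))"
      by (subst compactin_PiE) (simp add: finite_imp_compact)
    then have "compact (PiE UNIV (\<lambda>i. {..m i}))"
      by (simp add: euclidean_product_topology)
    then have "seq_compact (PiE UNIV (\<lambda>i. {..m i}))"
      by (rule compact_imp_seq_compact)
    moreover have "s n \<in> PiE UNIV (\<lambda>i. {..m i})" for n
      by (auto simp: s_def)
    ultimately have "\<exists>l q. strict_mono q \<and> (s \<circ> q) \<longlonglongrightarrow> l"
      unfolding seq_compact_def by blast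
    then obtain l q where q: "strict_mono q" "(s \<circ> q) \<longlonglongrightarrow> l"
      by blast
    have "(\<lambda>n. snd (z (q n)) i) \<longlonglongrightarrow> l i" for i
    proof -
      have "(\<lambda>n. s (q n) i) \<longlonglongrightarrow> l i"
        using continuous_on_tendsto_compose[OF continuous_on_product_coordinates[of i] q(2)]
        by (simp add: o_def)
      moreover have "eventually (\<lambda>n. s (q n) i = snd (z (q n)) i) sequentially"
        using eventually_gt_at_top[of i]
      proof eventually_elim
        case (elim n)
        then have "i < q n"
          using seq_suble[OF q(1), of n] by linarith
        then show ?case
          using z(2)[of i "q n"] by (simp add: s_def)
      qed
      ultimately show ?thesis
        by (simp add: tendsto_cong)
    qed
    then have "(\<lambda>n. snd (z (q n))) \<longlonglongrightarrow> l"
      using limitin_componentwise[of "\<lambda>_. euclidean :: nat topology" UNIV "\<lambda>n. snd (z (q n))" l sequentially]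
      by (simp add: euclidean_product_topology)
    moreover have "(\<lambda>n. fst (z n)) \<longlonglongrightarrow> x"
    proof (rule metric_LIMSEQ_I)
      fix e :: real assume "0 < e"
      then obtain n0 where "inverse (real (Suc n0)) < e"
        using reals_Archimedean by blast
      then have "dist (fst (z n)) x < e" if "n \<ge> n0" for n
        
      proof -
        have "inverse (real (Suc n)) \<le> inverse (real (Suc n0))"
          using that by (intro le_imp_inverse_le) auto
        then show ?thesis
          using z(3)[of n] \<open>inverse (real (Suc n0)) < e\<close> by linarith
      qed
      then show "\<exists>n0. \<forall>n\<ge>n0. dist (fst (z n)) x < e"
        by blast
    qed
    then have "(\<lambda>n. fst (z (q n))) \<longlonglongrightarrow> x"
      using LIMSEQ_subseq_LIMSEQ[OF _ q(1)] by (simp add: o_def)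
    ultimately have "(\<lambda>n. (fst (z (q n)), snd (z (q n)))) \<longlonglongrightarrow> (x, l)"
      by (intro tendsto_Pair)
    then have "(x, l) \<in> G"
      using z(1) G(1) closed_sequentially[of G "\<lambda>n. z (q n)"] by simp
    then show "x \<in> B"
      unfolding G by force
  qed
  ultimately show ?thesis
    by blast
qed

section \<open>The Hahn-Banach theorem\<close>

text \<open>
  Linear spaces of real functions are given by carrier sets, because they will be the functions
  that are continuous on a fixed compact set.
\<close>
definition function_space :: "('b \<Rightarrow> real) set \<Rightarrow> bool" where
  "function_space V \<longleftrightarrow> V \<noteq> {} \<and> (\<forall>g\<in>V. \<forall>h\<in>V. (\<lambda>x. g x + h x) \<in> V) \<and> (\<forall>h\<in>V. \<forall>t. (\<lambda>x. t * h x) \<in> V)"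

definition sublinear_on :: "('b \<Rightarrow> real) set \<Rightarrow> (('b \<Rightarrow> real) \<Rightarrow> real) \<Rightarrow> bool" where
  "sublinear_on V p \<longleftrightarrow> (\<forall>g\<in>V. \<forall>h\<in>V. p (\<lambda>x. g x + h x) \<le> p g + p h) \<and>
     (\<forall>h\<in>V. \<forall>t\<ge>0. p (\<lambda>x. t * h x) = t * p h)"

definition linear_functional_on :: "('b \<Rightarrow> real) set \<Rightarrow> (('b \<Rightarrow> real) \<Rightarrow> real) \<Rightarrow> bool" where
  "linear_functional_on V p \<longleftrightarrow> (\<forall>g\<in>V. \<forall>h\<in>V. p (\<lambda>x. g x + h x) = p g + p h) \<and>
     (\<forall>h\<in>V. \<forall>t. p (\<lambda>x. t * h x) = t * p h)"

lemma sublinear_onD: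
  assumes "sublinear_on V p"
  shows "\<And>g h. g \<in> V \<Longrightarrow> h \<in> V \<Longrightarrow> p (\<lambda>x. g x + h x) \<le> p g + p h"
    and "\<And>h t. h \<in> V \<Longrightarrow> 0 \<le> t \<Longrightarrow> p (\<lambda>x. t * h x) = t * p h"
   apply (rule assms[unfolded sublinear_on_def, THEN conjunct1, THEN bspec, THEN bspec])
    apply assumption+
  apply (rule assms[unfolded sublinear_on_def, THEN conjunct2, THEN bspec, THEN spec, THEN mp])
   apply assumption+
  done

lemma linear_functional_onD:
  assumes "linear_functional_on V p"
  shows "\<And>g h. g \<in> V \<Longrightarrow> h \<in> V \<Longrightarrow> p (\<lambda>x. g x + h x) = p g + p h"
    and "\<And>h t. h \<in> V \<Longrightarrow> p (\<lambda>x. t * h x) = t * p h"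
   apply (rule assms[unfolded linear_functional_on_def, THEN conjunct1, THEN bspec, THEN bspec])
    apply assumption+
  apply (rule assms[unfolded linear_functional_on_def, THEN conjunct2, THEN bspec, THEN spec])
  apply assumption
  done

lemma sublinear_on_uminus_ge:
  assumes "function_space V" "sublinear_on V p" "h \<in> V"
  shows "- p (\<lambda>x. - h x) \<le> p h"
proof -
  have m: "(\<lambda>x. - h x) \<in> V"
    using assms(1,3) unfolding function_space_def by (metis (no_types, lifting) ext mult_minus1)
  have "0 = p (\<lambda>x. 0 * h x)"
    using sublinear_onD(2)[OF assms(2,3), of 0] by simp
  also have "\<dots> = p (\<lambda>x. h x + - h x)"
    by simp
  also have "\<dots> \<le> p h + p (\<lambda>x. - h x)"
    by (rule sublinear_onD(1)[OF assms(2,3) m])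
  finally show ?thesis
    by linarith
qed

text \<open>
  Both infima in the proof of the Hahn-Banach theorem, over a chain and over a half-line, are
  sublinear for the reason isolated here: two members of the family that are used at \<open>g\<close> and at \<open>h\<close> can
  be replaced by one member at \<open>g + h\<close>.
\<close>
lemma sublinear_on_cINF_I:
  fixes q :: "'i \<Rightarrow> ('b \<Rightarrow> real) \<Rightarrow> real"
  assumes V: "function_space V" and "I \<noteq> {}"
    and bdd: "\<And>h. h \<in> V \<Longrightarrow> bdd_below ((\<lambda>i. q i h) ` I)"
    and add: "\<And>g h i j. g \<in> V \<Longrightarrow> h \<in> V \<Longrightarrow> i \<in> I \<Longrightarrow> j \<in> I \<Longrightarrow>
       \<exists>k\<in>I. q k (\<lambda>x. g x + h x) \<le> q i g + q j h"
    and scale: "\<And>h i t. h \<in> V \<Longrightarrow> i \<in> I \<Longrightarrow> 0 < t \<Longrightarrow> \<exists>k\<in>I. q k (\<lambda>x. t * h x) \<le> t * q i h"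
    and zero: "\<And>i. i \<in> I \<Longrightarrow> q i (\<lambda>x. 0) = 0"
    and u: "\<And>h. h \<in> V \<Longrightarrow> u h = (INF i\<in>I. q i h)"
  shows "sublinear_on V u"
proof -
  have Vadd: "(\<lambda>x. g x + h x) \<in> V" if "g \<in> V" "h \<in> V" for g h
    using V that by (auto simp: function_space_def)
  have Vscale: "(\<lambda>x. t * h x) \<in> V" if "h \<in> V" for h and t :: real
    using V that by (auto simp: function_space_def)
  have u_le: "u h \<le> q i h" if "h \<in> V" "i \<in> I" for h i
    using that by (simp add: u cINF_lower[OF bdd])
  have le_u: "m \<le> u h" if "h \<in> V" "\<And>i. i \<in> I \<Longrightarrow> m \<le> q i h" for h m
    using that \<open>I \<noteq> {}\<close> by (simp add: u cINF_greatest)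
  have "u (\<lambda>x. g x + h x) \<le> u g + u h" if gh: "g \<in> V" "h \<in> V" for g h
  proof -
    have *: "u (\<lambda>x. g x + h x) \<le> q i g + q j h" if "i \<in> I" "j \<in> I" for i j
      using add[OF gh that] u_le[OF Vadd[OF gh]] order_trans by blast
    have "u (\<lambda>x. g x + h x) - q i g \<le> u h" if "i \<in> I" for i
    proof (rule le_u[OF gh(2)])
      show "u (\<lambda>x. g x + h x) - q i g \<le> q j h" if "j \<in> I" for j
        using *[OF \<open>i \<in> I\<close> that] by linarith
    qed
    then have "u (\<lambda>x. g x + h x) - u h \<le> q i g" if "i \<in> I" for i
      using that by (simp add: algebra_simps)
    then have "u (\<lambda>x. g x + h x) - u h \<le> u g"
      by (rule le_u[OF gh(1)])
    then show ?thesis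
      by linarith
  qed
  moreover have "u (\<lambda>x. t * h x) = t * u h" if h: "h \<in> V" and t: "0 \<le> t" for h t
  proof (cases "t = 0")
    case True
    obtain i where "i \<in> I"
      using \<open>I \<noteq> {}\<close> by blast
    have "(\<lambda>x. 0) \<in> V"
      using Vscale[OF h, of 0] by simp
    have "u (\<lambda>x. 0) = 0"
    proof (rule antisym)
      show "u (\<lambda>x. 0) \<le> 0"
        using u_le[OF \<open>(\<lambda>x. 0) \<in> V\<close> \<open>i \<in> I\<close>] zero[OF \<open>i \<in> I\<close>] by linarith
      show "0 \<le> u (\<lambda>x. 0)"
        by (rule le_u[OF \<open>(\<lambda>x. 0) \<in> V\<close>]) (simp add: zero)
    qed
    with True show ?thesis
      by simp
  next
    case False
    have *: "u (\<lambda>x. t * h x) \<le> t * u h" if h: "h \<in> V" and t: "0 < t" for h t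
    proof -
      have "u (\<lambda>x. t * h x) / t \<le> q i h" if "i \<in> I" for i
      proof -
        obtain j where "j \<in> I" "q j (\<lambda>x. t * h x) \<le> t * q i h"
          using scale[OF h \<open>i \<in> I\<close> t] by blast
        with u_le[OF Vscale[OF h, of t] \<open>j \<in> I\<close>] have "u (\<lambda>x. t * h x) \<le> t * q i h"
          by linarith
        then show ?thesis
          using t by (simp add: pos_divide_le_eq mult.commute)
      qed
      then have "u (\<lambda>x. t * h x) / t \<le> u h"
        by (rule le_u[OF h])
      then show ?thesis
        using t by (simp add: pos_divide_le_eq mult.commute)
    qed
    have "u h \<le> (1 / t) * u (\<lambda>x. t * h x)"
    proof -
      have "(\<lambda>x. (1 / t) * (t * h x)) = h"
        using False by simp
      then show ?thesis
        using *[OF Vscale[OF h, of t], of "1 / t"] False t by simp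
    qed
    moreover have "u (\<lambda>x. t * h x) \<le> t * u h"
      using * h t False by simp
    ultimately show ?thesis
      using False t by (simp add: field_simps)
  qed
  ultimately show ?thesis
    unfolding sublinear_on_def by blast
qed

text \<open>
  By Zorn's lemma there is a minimal sublinear functional \<open>m\<close> below \<open>p\<close>. Replacing \<open>m\<close> by the infimum
  over \<open>t \<ge> 0\<close> of \<open>m (h + t k) - t m k\<close> gives a sublinear functional below \<open>m\<close> whose value at \<open>- k\<close> is
  at most \<open>- m k\<close>; by minimality it is \<open>m\<close>, so that \<open>m (- k) = - m k\<close> and \<open>m\<close> is linear.
\<close>
lemma hahn_banach:
  fixes p :: "('b \<Rightarrow> real) \<Rightarrow> real"
  assumes V: "function_space V" and p: "sublinear_on V p"
  shows "\<exists>\<psi>. linear_functional_on V \<psi> \<and> (\<forall>h\<in>V. \<psi> h \<le> p h)"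
proof -
  have Vadd: "(\<lambda>x. g x + h x) \<in> V" if "g \<in> V" "h \<in> V" for g h
    using V that by (auto simp: function_space_def)
  have Vscale: "(\<lambda>x. t * h x) \<in> V" if "h \<in> V" for h and t :: real
    using V that by (auto simp: function_space_def)
  have Vm: "(\<lambda>x. - h x) \<in> V" if "h \<in> V" for h
    using Vscale[OF that, of "- 1"] by simp
  have V0: "(\<lambda>x. 0) \<in> V"
    using V Vscale[of _ 0] by (auto simp: function_space_def)
  \<comment> \<open>the value 0 outside V makes the pointwise order antisymmetric\<close>
  define A where "A = {q. sublinear_on V q \<and> (\<forall>h\<in>V. q h \<le> p h) \<and> (\<forall>h. h \<notin> V \<longrightarrow> q h = 0)}"
  define P where "P q q' \<longleftrightarrow> (\<forall>h. q' h \<le> q h)" for q q' :: "('b \<Rightarrow> real) \<Rightarrow> real"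
  have lower: "- p (\<lambda>x. - h x) \<le> q h" if "q \<in> A" "h \<in> V" for q h
  proof -
    have "q (\<lambda>x. - h x) \<le> p (\<lambda>x. - h x)"
      using that Vm by (simp add: A_def)
    then show ?thesis
      using sublinear_on_uminus_ge[OF V, of q h] that by (simp add: A_def)
  qed
  have zero: "q (\<lambda>x. 0) = 0" if "q \<in> A" for q
    using that sublinear_onD(2)[of V q "\<lambda>x. 0" 0] V0 by (simp add: A_def)
  have "partial_order_on A (relation_of P A)"
  proof (rule partial_order_on_relation_ofI)
    show "P a c" if "P a b" "P b c" for a b c
      using that unfolding P_def by (meson order_trans)
    show "a = b" if "P a b" "P b a" for a b
      using that unfolding P_def by (meson antisym ext)
  qed (simp add: P_def)
  moreover have "\<exists>u\<in>A. \<forall>q\<in>C. P q u" if C: "C \<in> Chains (relation_of P A)" for C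
  proof (cases "C = {}")
    case True
    have "sublinear_on V (\<lambda>h. if h \<in> V then p h else 0)"
      unfolding sublinear_on_def using sublinear_onD[OF p] by (auto simp: Vadd Vscale)
    then have "(\<lambda>h. if h \<in> V then p h else 0) \<in> A"
      by (simp add: A_def)
    with True show ?thesis
      by blast
  next
    case False
    have CA: "q \<in> A" if "q \<in> C" for q
      using C that by (auto simp: Chains_def relation_of_def)
    have tot: "P q q' \<or> P q' q" if "q \<in> C" "q' \<in> C" for q q'
      using C that by (auto simp: Chains_def relation_of_def)
    define u where "u h = (if h \<in> V then INF q\<in>C. q h else 0)" for h
    have bdd: "bdd_below ((\<lambda>q. q h) ` C)" if "h \<in> V" for h
      using lower[OF CA that] by (auto simp: bdd_below_def)
    have "sublinear_on V u"
    proof (rule sublinear_on_cINF_I[OF V False bdd])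
      fix g h q q' assume gh: "g \<in> V" "h \<in> V" and q: "q \<in> C" "q' \<in> C"
      have sub: "r (\<lambda>x. g x + h x) \<le> r g + r h" if "r \<in> C" for r
        using CA[OF that] gh sublinear_onD(1)[of V r g h] by (simp add: A_def)
      show "\<exists>r\<in>C. r (\<lambda>x. g x + h x) \<le> q g + q' h"
        using tot[OF q]
      proof
        assume "P q q'"
        then have "q' (\<lambda>x. g x + h x) \<le> q g + q' h"
          using sub[OF q(2)] unfolding P_def by (meson add_mono_thms_linordered_semiring(3) order_trans)
        then show ?thesis using q by blast
      next
        assume "P q' q"
        then have "q (\<lambda>x. g x + h x) \<le> q g + q' h"
          using sub[OF q(1)] unfolding P_def by (meson add_mono_thms_linordered_semiring(2) order_trans)
        then show ?thesis using q by blast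
      qed
    next
      fix h q and t :: real assume "h \<in> V" "q \<in> C" "0 < t"
      then have "q (\<lambda>x. t * h x) \<le> t * q h"
        using CA[of q] sublinear_onD(2)[of V q h t] by (simp add: A_def)
      then show "\<exists>r\<in>C. r (\<lambda>x. t * h x) \<le> t * q h"
        using \<open>q \<in> C\<close> by blast
    qed (auto simp: u_def zero CA)
    moreover have u_le: "u h \<le> q h" if "q \<in> C" for h q
      using that CA[OF that] by (auto simp: u_def A_def intro!: cINF_lower[OF bdd])
    moreover have "u h \<le> p h" if "h \<in> V" for h
    proof -
      obtain q where "q \<in> C"
        using False by blast
      then have "q h \<le> p h"
        using CA that by (simp add: A_def)
      then show ?thesis
        using u_le[OF \<open>q \<in> C\<close>, of h] by linarith
    qed
    ultimately have "u \<in> A"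
      by (simp add: A_def u_def)
    then show ?thesis
      using u_le by (auto simp: P_def)
  qed
  ultimately obtain m where m: "m \<in> A" "\<And>q. q \<in> A \<Longrightarrow> P m q \<Longrightarrow> q = m"
    using predicate_Zorn[of A P] by auto
  have msub: "sublinear_on V m"
    using m(1) by (simp add: A_def)
  have neg: "m (\<lambda>x. - k x) = - m k" if k: "k \<in> V" for k
  proof -
    define r where "r t h = m (\<lambda>x. h x + t * k x) - t * m k" for t h
    define q where "q h = (if h \<in> V then INF t\<in>{0..}. r t h else 0)" for h
    have r_ge: "- m (\<lambda>x. - h x) \<le> r t h" if "h \<in> V" "0 \<le> t" for t h
    proof -
      have "m (\<lambda>x. t * k x) = m (\<lambda>x. (h x + t * k x) + - h x)"
        by simp
      also have "\<dots> \<le> m (\<lambda>x. h x + t * k x) + m (\<lambda>x. - h x)"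
        using that k by (intro sublinear_onD(1)[OF msub] Vadd Vscale Vm)
      finally show ?thesis
        using sublinear_onD(2)[OF msub k \<open>0 \<le> t\<close>] by (simp add: r_def)
    qed
    have bdd: "bdd_below ((\<lambda>t. r t h) ` {0..})" if "h \<in> V" for h
      using r_ge[OF that] by (auto simp: bdd_below_def)
    have "sublinear_on V q"
    proof (rule sublinear_on_cINF_I[OF V _ bdd])
      fix g h and s t :: real assume gh: "g \<in> V" "h \<in> V" and st: "s \<in> {0..}" "t \<in> {0..}"
      have "m (\<lambda>x. (g x + s * k x) + (h x + t * k x)) \<le> m (\<lambda>x. g x + s * k x) + m (\<lambda>x. h x + t * k x)"
        using gh k by (intro sublinear_onD(1)[OF msub] Vadd Vscale)
      moreover have "(\<lambda>x. (g x + s * k x) + (h x + t * k x)) = (\<lambda>x. (g x + h x) + (s + t) * k x)"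
        by (auto simp: algebra_simps)
      ultimately have "r (s + t) (\<lambda>x. g x + h x) \<le> r s g + r t h"
        by (simp add: r_def algebra_simps)
      then show "\<exists>t'\<in>{0..}. r t' (\<lambda>x. g x + h x) \<le> r s g + r t h"
        using st by (intro bexI[of _ "s + t"]) auto
    next
      fix h and s t :: real assume h: "h \<in> V" and st: "s \<in> {0..}" "0 < t"
      have "m (\<lambda>x. t * (h x + s * k x)) = t * m (\<lambda>x. h x + s * k x)"
        using h k st by (intro sublinear_onD(2)[OF msub] Vadd Vscale) auto
      moreover have "(\<lambda>x. t * (h x + s * k x)) = (\<lambda>x. t * h x + (t * s) * k x)"
        by (auto simp: algebra_simps)
      ultimately have "r (t * s) (\<lambda>x. t * h x) \<le> t * r s h"
        by (simp add: r_def algebra_simps)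
      then show "\<exists>t'\<in>{0..}. r t' (\<lambda>x. t * h x) \<le> t * r s h"
        using st by (intro bexI[of _ "t * s"]) auto
    next
      show "r s (\<lambda>x. 0) = 0" if "s \<in> {0..}" for s
        using that sublinear_onD(2)[OF msub k, of s] by (simp add: r_def)
    qed (auto simp: q_def)
    moreover have q_le: "q h \<le> m h" for h
    proof (cases "h \<in> V")
      case True
      then have "q h \<le> r 0 h"
        unfolding q_def by (auto intro!: cINF_lower[OF bdd])
      then show ?thesis
        by (simp add: r_def)
    next
      case False
      then show ?thesis
        using m(1) by (simp add: q_def A_def)
    qed
    moreover have "q h \<le> p h" if "h \<in> V" for h
      using q_le[of h] m(1) that by (fastforce simp: A_def)
    ultimately have "q \<in> A"
      by (simp add: A_def q_def)
    then have "q = m"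
      using m(2) q_le by (simp add: P_def)
    have "q (\<lambda>x. - k x) \<le> r 1 (\<lambda>x. - k x)"
      unfolding q_def using Vm[OF k] by (auto intro!: cINF_lower[OF bdd])
    then have "m (\<lambda>x. - k x) \<le> - m k"
      using zero[OF m(1)] \<open>q = m\<close> by (simp add: r_def)
    then show ?thesis
      using sublinear_on_uminus_ge[OF V msub k] by linarith
  qed
  have "m (\<lambda>x. g x + h x) = m g + m h" if gh: "g \<in> V" "h \<in> V" for g h
  proof -
    have "m (\<lambda>x. - g x + - h x) \<le> m (\<lambda>x. - g x) + m (\<lambda>x. - h x)"
      using gh by (intro sublinear_onD(1)[OF msub] Vm)
    moreover have "m (\<lambda>x. - g x + - h x) = - m (\<lambda>x. g x + h x)"
      using neg[OF Vadd[OF gh]] by simp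
    ultimately show ?thesis
      using sublinear_onD(1)[OF msub gh] neg[OF gh(1)] neg[OF gh(2)] by linarith
  qed
  moreover have "m (\<lambda>x. t * h x) = t * m h" if h: "h \<in> V" for h t
  proof (cases "0 \<le> t")
    case False
    then have "m (\<lambda>x. (- t) * h x) = (- t) * m h"
      using h by (intro sublinear_onD(2)[OF msub]) auto
    then show ?thesis
      using neg[OF Vscale[OF h, of t]] by simp
  qed (simp add: sublinear_onD(2)[OF msub h])
  ultimately have "linear_functional_on V m"
    unfolding linear_functional_on_def by blast
  then show ?thesis
    using m(1) by (auto simp: A_def)
qed

abbreviation cont :: "'b::topological_space set \<Rightarrow> ('b \<Rightarrow> real) set" where
  "cont S \<equiv> {h. continuous_on S h}"

section \<open>Means and their outer measures\<close>

text \<open>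
  For compact \<open>S\<close> these are, by the Riesz representation theorem, the integrals against regular Borel
  probability measures on \<open>S\<close>.
\<close>
definition mean_on :: "'b::topological_space set \<Rightarrow> (('b \<Rightarrow> real) \<Rightarrow> real) \<Rightarrow> bool" where
  "mean_on S \<psi> \<longleftrightarrow> linear_functional_on (cont S) \<psi> \<and> \<psi> (\<lambda>x. 1) = 1 \<and>
     (\<forall>h\<in>cont S. (\<forall>x\<in>S. 0 \<le> h x) \<longrightarrow> 0 \<le> \<psi> h)"

lemma mean_on_add:
  assumes "mean_on S \<psi>" "continuous_on S g" "continuous_on S h"
  shows "\<psi> (\<lambda>x. g x + h x) = \<psi> g + \<psi> h"
  using assms linear_functional_onD(1)[of "cont S" \<psi> g h] by (simp add: mean_on_def)

lemma mean_on_mult: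
  assumes "mean_on S \<psi>" "continuous_on S h"
  shows "\<psi> (\<lambda>x. t * h x) = t * \<psi> h"
  using assms linear_functional_onD(2)[of "cont S" \<psi> h t] by (simp add: mean_on_def)

lemma mean_on_const: "mean_on S \<psi> \<Longrightarrow> \<psi> (\<lambda>x. t) = t"
  using mean_on_mult[of S \<psi> "\<lambda>x. 1" t] by (simp add: mean_on_def)

lemma mean_on_mono:
  assumes "mean_on S \<psi>" "continuous_on S g" "continuous_on S h" "\<And>x. x \<in> S \<Longrightarrow> g x \<le> h x"
  shows "\<psi> g \<le> \<psi> h"
proof -
  have "continuous_on S (\<lambda>x. h x - g x)"
    using assms by (intro continuous_intros)
  then have "0 \<le> \<psi> (\<lambda>x. h x - g x)"
    using assms unfolding mean_on_def by auto
  moreover have "\<psi> (\<lambda>x. (h x - g x) + g x) = \<psi> (\<lambda>x. h x - g x) + \<psi> g"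
    using assms by (intro mean_on_add[of S] continuous_intros)
  ultimately show ?thesis
    by simp
qed

text \<open>
  Separation of a convex cone \<open>\<Phi>\<close> from the negative functions: the least \<open>m\<close> with \<open>m - h \<in> \<Phi>\<close> is a
  sublinear function of \<open>h\<close>. It is finite because no member of \<open>\<Phi>\<close> is negative everywhere, and it is at
  most \<open>0\<close> at the negatives of members of \<open>\<Phi>\<close>, so that every linear functional below it is nonnegative
  on \<open>\<Phi>\<close>.
\<close>
lemma mean_nonneg_on_cone:
  fixes S :: "'b::topological_space set"
  assumes S: "compact S" "S \<noteq> {}"
    and cont: "\<Phi> \<subseteq> cont S"
    and nonneg: "\<And>h. continuous_on S h \<Longrightarrow> (\<And>x. x \<in> S \<Longrightarrow> 0 \<le> h x) \<Longrightarrow> h \<in> \<Phi>"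
    and add: "\<And>g h. g \<in> \<Phi> \<Longrightarrow> h \<in> \<Phi> \<Longrightarrow> (\<lambda>x. g x + h x) \<in> \<Phi>"
    and scale: "\<And>h t. h \<in> \<Phi> \<Longrightarrow> 0 < t \<Longrightarrow> (\<lambda>x. t * h x) \<in> \<Phi>"
    and pos: "\<And>h. h \<in> \<Phi> \<Longrightarrow> \<exists>x\<in>S. 0 \<le> h x"
  shows "\<exists>\<psi>. mean_on S \<psi> \<and> (\<forall>h\<in>\<Phi>. 0 \<le> \<psi> h)"
proof -
  have V: "function_space (cont S)"
    unfolding function_space_def by (auto intro!: continuous_intros exI[of _ "\<lambda>x. 0"])
  define M where "M h = {m. (\<lambda>x. m - h x) \<in> \<Phi>}" for h
  define p where "p h = Inf (M h)" for h
  have bound: "\<exists>b. \<forall>x\<in>S. \<bar>h x\<bar> \<le> b" if "continuous_on S h" for h :: "'b \<Rightarrow> real"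
    using compact_imp_bounded[OF compact_continuous_image[OF that S(1)]]
    by (auto simp: bounded_iff)
  have M_ne: "M h \<noteq> {}" if h: "continuous_on S h" for h
  proof -
    obtain b where "\<And>x. x \<in> S \<Longrightarrow> \<bar>h x\<bar> \<le> b"
      using bound[OF h] by blast
    then have "0 \<le> b - h x" if "x \<in> S" for x
      using that by fastforce
    then have "b \<in> M h"
      unfolding M_def using h by (auto intro!: nonneg continuous_intros)
    then show ?thesis by blast
  qed
  have M_bdd: "bdd_below (M h)" if h: "continuous_on S h" for h
  proof -
    obtain b where b: "\<And>x. x \<in> S \<Longrightarrow> \<bar>h x\<bar> \<le> b"
      using bound[OF h] by blast
    have "- b \<le> m" if m: "m \<in> M h" for m
    proof -
      obtain x where "x \<in> S" "0 \<le> m - h x"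
        using pos[of "\<lambda>x. m - h x"] m by (auto simp: M_def)
      then show ?thesis using b[of x] by linarith
    qed
    then show ?thesis
      by (auto simp: bdd_below_def)
  qed
  have p_le: "p h \<le> m" if "continuous_on S h" "m \<in> M h" for h m
    unfolding p_def by (rule cInf_lower[OF that(2) M_bdd[OF that(1)]])
  have le_p: "m \<le> p h" if "continuous_on S h" "\<And>m'. m' \<in> M h \<Longrightarrow> m \<le> m'" for h m
    unfolding p_def by (rule cInf_greatest[OF M_ne[OF that(1)] that(2)])
  have "sublinear_on (cont S) p"
    unfolding sublinear_on_def
  proof (intro conjI ballI allI impI)
    fix g h assume "g \<in> cont S" "h \<in> cont S"
    then have gh: "continuous_on S g" "continuous_on S h" "continuous_on S (\<lambda>x. g x + h x)"
      by (auto intro!: continuous_intros)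
    have *: "p (\<lambda>x. g x + h x) \<le> m + m'" if "m \<in> M g" "m' \<in> M h" for m m'
    proof (rule p_le[OF gh(3)])
      have "(\<lambda>x. (m - g x) + (m' - h x)) \<in> \<Phi>"
        using that add[of "\<lambda>x. m - g x" "\<lambda>x. m' - h x"] by (simp add: M_def)
      then show "m + m' \<in> M (\<lambda>x. g x + h x)"
        unfolding M_def by (simp add: algebra_simps)
    qed
    have "p (\<lambda>x. g x + h x) - m \<le> p h" if "m \<in> M g" for m
      by (rule le_p[OF gh(2)]) (use *[OF that] in \<open>simp add: algebra_simps\<close>)
    then have "p (\<lambda>x. g x + h x) - p h \<le> p g"
      by (intro le_p[OF gh(1)]) (simp add: algebra_simps)
    then show "p (\<lambda>x. g x + h x) \<le> p g + p h"
      by simp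
  next
    fix h and t :: real assume "h \<in> cont S" "0 \<le> t"
    have *: "p (\<lambda>x. t * h x) \<le> t * p h" if h: "continuous_on S h" and t: "0 < t" for h t
    proof -
      have th: "continuous_on S (\<lambda>x. t * h x)"
        using h by (intro continuous_intros)
      have "p (\<lambda>x. t * h x) / t \<le> m" if "m \<in> M h" for m
      proof -
        have "(\<lambda>x. t * (m - h x)) \<in> \<Phi>"
          using that scale[of "\<lambda>x. m - h x" t] t by (simp add: M_def)
        then have "t * m \<in> M (\<lambda>x. t * h x)"
          unfolding M_def by (simp add: algebra_simps)
        then show ?thesis
          using p_le[OF th] t by (simp add: pos_divide_le_eq mult.commute)
      qed
      then show ?thesis
        using le_p[OF h, of "p (\<lambda>x. t * h x) / t"] t by (simp add: pos_divide_le_eq mult.commute)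
    qed
    show "p (\<lambda>x. t * h x) = t * p h"
    proof (cases "t = 0")
      case True
      have c0: "continuous_on S (\<lambda>x. 0 :: real)"
        by simp
      have "p (\<lambda>x. 0) \<le> 0"
        by (rule p_le[OF c0]) (simp add: M_def nonneg)
      moreover have "0 \<le> p (\<lambda>x. 0)"
      proof (rule le_p[OF c0])
        show "0 \<le> m" if "m \<in> M (\<lambda>x. 0)" for m
          using that pos[of "\<lambda>x. m"] by (auto simp: M_def)
      qed
      ultimately show ?thesis
        using True by simp
    next
      case False
      then have t: "0 < t" and h: "continuous_on S h"
        using \<open>0 \<le> t\<close> \<open>h \<in> cont S\<close> by auto
      have "(\<lambda>x. (1 / t) * (t * h x)) = h"
        using False by simp
      moreover have "p (\<lambda>x. (1 / t) * (t * h x)) \<le> (1 / t) * p (\<lambda>x. t * h x)"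
        using t h by (intro * continuous_intros) auto
      ultimately have "t * p h \<le> p (\<lambda>x. t * h x)"
        using t by (simp add: pos_le_divide_eq mult.commute)
      then show ?thesis
        using *[OF h t] by linarith
    qed
  qed
  from hahn_banach[OF V this] obtain \<psi>
    where \<psi>: "linear_functional_on (cont S) \<psi>" "\<And>h. h \<in> cont S \<Longrightarrow> \<psi> h \<le> p h"
    by blast
  have neg: "\<psi> (\<lambda>x. - h x) = - \<psi> h" if "h \<in> cont S" for h
  proof -
    have "\<psi> (\<lambda>x. (- 1) * h x) = (- 1) * \<psi> h"
      by (rule linear_functional_onD(2)[OF \<psi>(1) that])
    then show ?thesis by simp
  qed
  have \<psi>\<Phi>: "0 \<le> \<psi> h" if h: "h \<in> \<Phi>" for h
  proof -
    have c: "continuous_on S (\<lambda>x. - h x)"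
      using cont h by (intro continuous_on_minus) blast
    have "p (\<lambda>x. - h x) \<le> 0"
      by (rule p_le[OF c]) (simp add: M_def h)
    then show ?thesis
      using \<psi>(2)[of "\<lambda>x. - h x"] neg[of h] c cont h by (simp add: subset_iff)
  qed
  have "p (\<lambda>x. 1) \<le> 1"
    by (rule p_le) (simp_all add: M_def nonneg)
  then have "\<psi> (\<lambda>x. 1) \<le> 1"
    using \<psi>(2)[of "\<lambda>x. 1"] by simp
  moreover have "p (\<lambda>x. - 1) \<le> - 1"
    by (rule p_le) (simp_all add: M_def nonneg)
  then have "\<psi> (\<lambda>x. - 1) \<le> - 1"
    using \<psi>(2)[of "\<lambda>x. - 1"] by simp
  ultimately have "\<psi> (\<lambda>x. 1) = 1"
    using neg[of "\<lambda>x. 1"] by simp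
  then have "mean_on S \<psi>"
    unfolding mean_on_def using \<psi>(1) \<psi>\<Phi> nonneg by simp
  then show ?thesis
    using \<psi>\<Phi> by blast
qed

text \<open>
  Increasing sequences stand for their lower semicontinuous suprema. The strict inequality \<open>1 < h k x\<close>
  makes the covered set open in \<open>S\<close>; as the sequences increase, a point covered by two of them is
  covered by their minimum.
\<close>
definition covering :: "'b::topological_space set \<Rightarrow> 'b set \<Rightarrow> (nat \<Rightarrow> 'b \<Rightarrow> real) \<Rightarrow> bool" where
  "covering S E h \<longleftrightarrow> (\<forall>k. continuous_on S (h k)) \<and>
     (\<forall>k. \<forall>x\<in>S. 0 \<le> h k x \<and> h k x \<le> h (Suc k) x) \<and> (\<forall>x\<in>E. \<exists>k. 1 < h k x)"

text \<open>
  For compact \<open>S\<close> and the measure that represents \<open>\<psi>\<close> this is the outer measure of \<open>E\<close>.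
\<close>
definition outer_mean :: "'b::topological_space set \<Rightarrow> (('b \<Rightarrow> real) \<Rightarrow> real) \<Rightarrow> 'b set \<Rightarrow> real" where
  "outer_mean S \<psi> E = Inf {t. \<exists>h. covering S E h \<and> (\<forall>k. \<psi> (h k) \<le> t)}"

lemma coveringD:
  assumes "covering S E h"
  shows "continuous_on S (h k)" "x \<in> S \<Longrightarrow> 0 \<le> h k x" "x \<in> S \<Longrightarrow> j \<le> k \<Longrightarrow> h j x \<le> h k x"
    "x \<in> E \<Longrightarrow> \<exists>k. 1 < h k x"
  using assms lift_Suc_mono_le[of "\<lambda>k. h k x" j k] by (auto simp: covering_def)

context
  fixes S :: "'b::t2_space set" and \<psi>
  assumes \<psi>: "mean_on S \<psi>"
begin

lemma outer_mean_le:
  assumes h: "covering S E h" and t: "\<And>k. \<psi> (h k) \<le> t"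
  shows "outer_mean S \<psi> E \<le> t"
  unfolding outer_mean_def
proof (rule cInf_lower)
  show "t \<in> {t. \<exists>h. covering S E h \<and> (\<forall>k. \<psi> (h k) \<le> t)}"
    using assms by blast
  have "0 \<le> t" if "covering S E h" "\<forall>k. \<psi> (h k) \<le> t" for h t
  proof -
    have "0 \<le> \<psi> (h 0)"
      using \<psi> coveringD(1,2)[OF that(1)] unfolding mean_on_def by blast
    then show ?thesis
      using that(2) order_trans by blast
  qed
  then show "bdd_below {t. \<exists>h. covering S E h \<and> (\<forall>k. \<psi> (h k) \<le> t)}"
    by (intro bdd_belowI[of _ 0]) blast
qed

lemma le_outer_mean:
  assumes "\<And>h t. covering S E h \<Longrightarrow> (\<And>k. \<psi> (h k) \<le> t) \<Longrightarrow> r \<le> t"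
  shows "r \<le> outer_mean S \<psi> E"
  unfolding outer_mean_def
proof (rule cInf_greatest)
  have "covering S E (\<lambda>k x. 2)"
    by (simp add: covering_def)
  then show "{t. \<exists>h. covering S E h \<and> (\<forall>k. \<psi> (h k) \<le> t)} \<noteq> {}"
    using mean_on_const[OF \<psi>, of 2] by (auto intro!: exI[of _ 2] exI[of _ "\<lambda>k x. 2"])
qed (use assms in blast)

lemma outer_mean_less:
  assumes "outer_mean S \<psi> E < r"
  shows "\<exists>h. covering S E h \<and> (\<forall>k. \<psi> (h k) \<le> r)"
proof (rule ccontr)
  assume "\<nexists>h. covering S E h \<and> (\<forall>k. \<psi> (h k) \<le> r)"
  then have "r \<le> outer_mean S \<psi> E"
    by (intro le_outer_mean) (meson le_cases order_trans)
  with assms show False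
    by linarith
qed

lemma outer_mean_mono: "E \<subseteq> E' \<Longrightarrow> outer_mean S \<psi> E \<le> outer_mean S \<psi> E'"
proof (rule le_outer_mean, rule outer_mean_le)
  show "covering S E h" if "E \<subseteq> E'" "covering S E' h" for h
    using that unfolding covering_def by blast
qed

text \<open>
  Strong subadditivity, from \<open>max + min = v + w\<close>: the minimum of the two sequences still covers the
  smaller set \<open>E\<close>, so that its mean is not much below the outer mean of \<open>E\<close>, and what is left for the
  maximum is the outer mean of \<open>E'\<close> up to the sum of the two errors.
\<close>
lemma outer_mean_step:
  assumes E: "E \<subseteq> E'" "E' \<subseteq> S"
    and v: "covering S E v" "\<And>k. \<psi> (v k) \<le> outer_mean S \<psi> E + e"
    and w: "covering S E' w" "\<And>k. \<psi> (w k) \<le> outer_mean S \<psi> E' + d"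
  shows "covering S E' (\<lambda>k x. max (v k x) (w k x))"
    and "\<psi> (\<lambda>x. max (v k x) (w k x)) \<le> outer_mean S \<psi> E' + (e + d)"
proof -
  let ?M = "\<lambda>k x. max (v k x) (w k x)" and ?m = "\<lambda>k x. min (v k x) (w k x)"
  note vD = coveringD[OF v(1)] and wD = coveringD[OF w(1)]
  show M: "covering S E' ?M"
    unfolding covering_def
  proof (intro conjI allI ballI)
    show "continuous_on S (?M k)" for k
      using vD(1) wD(1) by (intro continuous_intros)
    show "0 \<le> ?M k x" if "x \<in> S" for k x
      using vD(2)[OF that] by (simp add: le_max_iff_disj)
    show "?M k x \<le> ?M (Suc k) x" if "x \<in> S" for k x
      using vD(3)[OF that, of k "Suc k"] wD(3)[OF that, of k "Suc k"] by auto
    show "\<exists>k. 1 < ?M k x" if "x \<in> E'" for x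
      using wD(4)[OF that] by (auto simp: less_max_iff_disj)
  qed
  have m: "covering S E ?m"
    unfolding covering_def
  proof (intro conjI allI ballI)
    show "continuous_on S (?m k)" for k
      using vD(1) wD(1) by (intro continuous_intros)
    show "0 \<le> ?m k x" if "x \<in> S" for k x
      using vD(2)[OF that] wD(2)[OF that] by simp
    show "?m k x \<le> ?m (Suc k) x" if "x \<in> S" for k x
      using vD(3)[OF that, of k "Suc k"] wD(3)[OF that, of k "Suc k"] by auto
    show "\<exists>k. 1 < ?m k x" if x: "x \<in> E" for x
    proof -
      obtain i j where ij: "1 < v i x" "1 < w j x"
        using vD(4)[OF x] wD(4)[of x] E x by blast
      have "x \<in> S"
        using E x by blast
      then have "1 < ?m (max i j) x"
        using ij vD(3)[of x i "max i j"] wD(3)[of x j "max i j"] by auto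
      then show ?thesis ..
    qed
  qed
  show "\<psi> (?M k) \<le> outer_mean S \<psi> E' + (e + d)"
  proof -
    \<comment> \<open>every term of the minimum sequence is bounded with the fixed k, by passing to the larger index\<close>
    have "\<psi> (?m j) \<le> outer_mean S \<psi> E + e + (outer_mean S \<psi> E' + d) - \<psi> (?M k)" for j
    proof -
      let ?l = "max j k"
      have "\<psi> (\<lambda>x. ?M ?l x + ?m ?l x) = \<psi> (?M ?l) + \<psi> (?m ?l)"
        by (rule mean_on_add[OF \<psi> coveringD(1)[OF M] coveringD(1)[OF m]])
      moreover have "(\<lambda>x. ?M ?l x + ?m ?l x) = (\<lambda>x. v ?l x + w ?l x)"
        by (auto simp: max_def min_def)
      then have "\<psi> (\<lambda>x. ?M ?l x + ?m ?l x) = \<psi> (v ?l) + \<psi> (w ?l)"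
        by (simp only: mean_on_add[OF \<psi> vD(1) wD(1)])
      moreover have "\<psi> (?M k) \<le> \<psi> (?M ?l)"
        by (rule mean_on_mono[OF \<psi> coveringD(1)[OF M] coveringD(1)[OF M] coveringD(3)[OF M]]) auto
      moreover have "\<psi> (?m j) \<le> \<psi> (?m ?l)"
        by (rule mean_on_mono[OF \<psi> coveringD(1)[OF m] coveringD(1)[OF m] coveringD(3)[OF m]]) auto
      ultimately show ?thesis
        using v(2)[of ?l] w(2)[of ?l] by linarith
    qed
    from outer_mean_le[OF m this] show ?thesis
      by linarith
  qed
qed

text \<open>
  Almost optimal sequences \<open>w n\<close> for \<open>E n\<close> are replaced by their running
  maxima \<open>v n\<close>, whose errors add up to at most \<open>\<epsilon>\<close> by strong subadditivity; the diagonal of the \<open>v n\<close>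
  covers the union.
\<close>
lemma outer_mean_Union_le:
  assumes E: "incseq E" "\<And>n. E n \<subseteq> S" and r: "\<And>n. outer_mean S \<psi> (E n) \<le> r"
  shows "outer_mean S \<psi> (\<Union>n. E n) \<le> r"
proof (rule field_le_epsilon)
  fix \<epsilon> :: real assume "0 < \<epsilon>"
  have "\<exists>w. covering S (E n) w \<and> (\<forall>k. \<psi> (w k) \<le> outer_mean S \<psi> (E n) + \<epsilon> * (1/2) ^ Suc n)" for n
    using \<open>0 < \<epsilon>\<close> by (intro outer_mean_less) simp
  then have "\<forall>n. \<exists>w. covering S (E n) w \<and> (\<forall>k. \<psi> (w k) \<le> outer_mean S \<psi> (E n) + \<epsilon> * (1/2) ^ Suc n)"
    by blast
  from choice[OF this] obtain w where
    "\<forall>n. covering S (E n) (w n) \<and> (\<forall>k. \<psi> (w n k) \<le> outer_mean S \<psi> (E n) + \<epsilon> * (1/2) ^ Suc n)" ..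
  then have w: "\<And>n. covering S (E n) (w n)"
    "\<And>n k. \<psi> (w n k) \<le> outer_mean S \<psi> (E n) + \<epsilon> * (1/2) ^ Suc n"
    by simp_all
  define v where "v = rec_nat (w 0) (\<lambda>n h k x. max (h k x) (w (Suc n) k x))"
  have v_0: "v 0 = w 0" and v_Suc: "v (Suc n) = (\<lambda>k x. max (v n k x) (w (Suc n) k x))" for n
    by (simp_all add: v_def)
  have v: "covering S (E n) (v n) \<and> (\<forall>k. \<psi> (v n k) \<le> outer_mean S \<psi> (E n) + \<epsilon> * (1 - (1/2) ^ Suc n))" for n
  proof (induction n)
    case 0
    then show ?case
      using w[of 0] by (simp add: v_0)
  next
    case (Suc n)
    have "E n \<subseteq> E (Suc n)"
      using E(1) by (simp add: incseq_SucD)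
    from outer_mean_step[OF this E(2) _ _ w(1) w(2), of "v n" "\<epsilon> * (1 - (1/2) ^ Suc n)"] Suc
    have "covering S (E (Suc n)) (v (Suc n))"
      "\<And>k. \<psi> (v (Suc n) k) \<le> outer_mean S \<psi> (E (Suc n)) + (\<epsilon> * (1 - (1/2) ^ Suc n) + \<epsilon> * (1/2) ^ Suc (Suc n))"
      by (simp_all add: v_Suc)
    moreover have "\<epsilon> * (1 - (1/2) ^ Suc n) + \<epsilon> * (1/2) ^ Suc (Suc n) = \<epsilon> * (1 - (1/2) ^ Suc (Suc n))"
      by (simp add: field_simps)
    ultimately show ?case
      by simp
  qed
  have v_mono: "v n k x \<le> v (Suc n) k x" for n k x
    by (simp add: v_Suc)
  have "covering S (\<Union>n. E n) (\<lambda>k. v k k)"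
    unfolding covering_def
  proof (intro conjI allI ballI)
    show "continuous_on S (v k k)" for k
      using v coveringD(1) by blast
    show "0 \<le> v k k x" if "x \<in> S" for k x
      using v coveringD(2) that by blast
    show "v k k x \<le> v (Suc k) (Suc k) x" if "x \<in> S" for k x
    proof -
      have "v (Suc k) k x \<le> v (Suc k) (Suc k) x"
        using v[of "Suc k"] coveringD(3)[of S "E (Suc k)" "v (Suc k)" x k "Suc k"] that by simp
      then show ?thesis
        using v_mono[of k k x] by linarith
    qed
    show "\<exists>k. 1 < v k k x" if x: "x \<in> (\<Union>n. E n)" for x
    proof -
      obtain n where "x \<in> E n"
        using x by blast
      moreover from this obtain k where "1 < v n k x"
        using v[of n] coveringD(4)[of S "E n" "v n" x] by blast
      ultimately have nk: "x \<in> E n" "1 < v n k x" .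
      have "v n k x \<le> v (max n k) k x"
        by (rule lift_Suc_mono_le[of "\<lambda>n. v n k x", OF v_mono]) simp
      also have "\<dots> \<le> v (max n k) (max n k) x"
        using v[of "max n k"] E(2)[of n] nk(1)
          coveringD(3)[of S "E (max n k)" "v (max n k)" x k "max n k"] by auto
      finally show ?thesis
        using nk by (intro exI[of _ "max n k"]) linarith
    qed
  qed
  moreover have "\<psi> (v k k) \<le> r + \<epsilon>" for k
  proof -
    have "\<epsilon> * (1 - (1/2) ^ Suc k) \<le> \<epsilon>"
      using \<open>0 < \<epsilon>\<close> by (simp add: mult_le_cancel_left1)
    moreover have "\<psi> (v k k) \<le> outer_mean S \<psi> (E k) + \<epsilon> * (1 - (1/2) ^ Suc k)"
      using v[of k] by blast
    ultimately show ?thesis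
      using r[of k] by linarith
  qed
  ultimately show "outer_mean S \<psi> (\<Union>n. E n) \<le> r + \<epsilon>"
    by (rule outer_mean_le)
qed

text \<open>
  What covers the intersection covers an open set around it, hence already one of the compact sets.
\<close>
lemma outer_mean_Inter_ge:
  assumes K: "decseq K" "\<And>n. compact (K n)" "\<And>n. K n \<subseteq> S"
    and r: "\<And>n. r \<le> outer_mean S \<psi> (K n)"
  shows "r \<le> outer_mean S \<psi> (\<Inter>n. K n)"
proof (rule le_outer_mean)
  fix h t assume h: "covering S (\<Inter>n. K n) h" and t: "\<And>k. \<psi> (h k) \<le> t"
  define L where "L n = {x \<in> K n. \<forall>k. h k x \<le> 1}" for n
  have "compact (L n)" for n
  proof -
    have "continuous_on (K n) (h k)" for k
      using coveringD(1)[OF h] K(3) continuous_on_subset by blast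
    then have "closed (K n \<inter> h k -` {..1})" for k
      using continuous_on_closed_vimage[OF compact_imp_closed[OF K(2)]] by (metis closed_atMost inf_commute)
    then have "closed (\<Inter>k. K n \<inter> h k -` {..1})"
      by blast
    moreover have "L n = K n \<inter> (\<Inter>k. K n \<inter> h k -` {..1})"
      by (auto simp: L_def)
    ultimately show ?thesis
      using compact_Int_closed[OF K(2)] by metis
  qed
  moreover have "decseq L"
    using K(1) unfolding L_def decseq_def by blast
  moreover have "(\<Inter>n. L n) = {}"
  proof -
    have False if "x \<in> (\<Inter>n. L n)" for x
    proof -
      have "x \<in> (\<Inter>n. K n)" "\<And>k. h k x \<le> 1"
        using that unfolding L_def by blast+
      then show False
        using coveringD(4)[OF h, of x] by (meson linorder_not_le)
    qed
    then show ?thesis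
      by blast
  qed
  ultimately obtain n where n: "L n = {}"
    using decseq_compact_Inter_nonempty[of L] by blast
  have "covering S (K n) h"
  proof -
    have "\<exists>k. 1 < h k x" if "x \<in> K n" for x
    proof (rule ccontr)
      assume "\<nexists>k. 1 < h k x"
      then have "x \<in> L n"
        using that unfolding L_def by (simp add: linorder_not_less)
      then show False
        using n by blast
    qed
    then show ?thesis
      using h unfolding covering_def by blast
  qed
  then have "outer_mean S \<psi> (K n) \<le> t"
    using t by (rule outer_mean_le)
  then show "r \<le> t"
    using r[of n] by linarith
qed

text \<open>
  By compactness (as in Dini's theorem) one member of a sequence that covers \<open>S\<close> exceeds \<open>1\<close> on all of \<open>S\<close>.
\<close>
lemma outer_mean_space:
  assumes "compact S"
  shows "1 \<le> outer_mean S \<psi> S"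
proof (rule le_outer_mean)
  fix h t assume h: "covering S S h" and t: "\<And>k. \<psi> (h k) \<le> t"
  have "\<exists>k. \<forall>x\<in>S. 1 < h k x"
  proof (rule ccontr)
    assume "\<not> ?thesis"
    then have "\<exists>x\<in>S. h k x \<le> 1" for k
      by (meson linorder_not_le)
    then have ne: "{x \<in> S. h k x \<le> 1} \<noteq> {}" for k
      by blast
    have "compact {x \<in> S. h k x \<le> 1}" for k
    proof -
      have "closed (S \<inter> h k -` {..1})"
        using continuous_on_closed_vimage[OF compact_imp_closed[OF assms]] coveringD(1)[OF h]
        by (metis closed_atMost inf_commute)
      then have "compact (S \<inter> (S \<inter> h k -` {..1}))"
        using compact_Int_closed[OF assms] by blast
      moreover have "S \<inter> (S \<inter> h k -` {..1}) = {x \<in> S. h k x \<le> 1}"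
        by auto
      ultimately show ?thesis
        by simp
    qed
    moreover have "decseq (\<lambda>k. {x \<in> S. h k x \<le> 1})"
      unfolding decseq_def using coveringD(3)[OF h] by (auto intro: order_trans)
    ultimately have "(\<Inter>k. {x \<in> S. h k x \<le> 1}) \<noteq> {}"
      using ne by (intro decseq_compact_Inter_nonempty)
    then obtain x where "\<And>k. x \<in> S \<and> h k x \<le> 1"
      by blast
    then show False
      using coveringD(4)[OF h, of x] by (metis linorder_not_le)
  qed
  then obtain k where k: "\<And>x. x \<in> S \<Longrightarrow> 1 < h k x"
    by blast
  have "\<psi> (\<lambda>x. 1) \<le> \<psi> (h k)"
    by (rule mean_on_mono[OF \<psi>]) (use k coveringD(1)[OF h] in \<open>auto intro: less_imp_le\<close>)
  then show "1 \<le> t"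
    using mean_on_const[OF \<psi>, of 1] t[of k] by linarith
qed

text \<open>
  The function \<open>1 - h / M\<close> equals \<open>1\<close> on \<open>E\<close>, so a factor slightly above \<open>1\<close> turns it into a constant
  sequence that covers \<open>E\<close>.
\<close>
lemma mean_le_outer_mean_compl:
  assumes h: "continuous_on S h" "\<And>x. x \<in> S \<Longrightarrow> 0 \<le> h x" "\<And>x. x \<in> S \<Longrightarrow> h x \<le> M"
    and E: "E \<subseteq> S" "\<And>x. x \<in> E \<Longrightarrow> h x = 0" and "0 < M"
  shows "\<psi> h \<le> M * (1 - outer_mean S \<psi> E)"
proof -
  have "outer_mean S \<psi> E \<le> (1 + \<delta>) * (1 - \<psi> h / M)" if "0 < \<delta>" for \<delta>
  proof (rule outer_mean_le)
    show "covering S E (\<lambda>k x. (1 + \<delta>) * (1 - h x / M))"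
      unfolding covering_def
    proof (intro conjI allI ballI)
      show "continuous_on S (\<lambda>x. (1 + \<delta>) * (1 - h x / M))"
        using h(1) \<open>0 < M\<close> by (intro continuous_intros) auto
      show "0 \<le> (1 + \<delta>) * (1 - h x / M)" if "x \<in> S" for x
        using h(3)[OF that] \<open>0 < M\<close> \<open>0 < \<delta>\<close> by simp
      show "\<exists>k. 1 < (1 + \<delta>) * (1 - h x / M)" if "x \<in> E" for x
        using E(2)[OF that] \<open>0 < \<delta>\<close> by simp
    qed auto
    have "\<psi> (\<lambda>x. (1 + \<delta>) + (- (1 + \<delta>) / M) * h x) = \<psi> (\<lambda>x. 1 + \<delta>) + \<psi> (\<lambda>x. (- (1 + \<delta>) / M) * h x)"
      using h(1) by (intro mean_on_add[OF \<psi>] continuous_intros)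
    also have "\<dots> = (1 + \<delta>) + (- (1 + \<delta>) / M) * \<psi> h"
      by (simp only: mean_on_const[OF \<psi>] mean_on_mult[OF \<psi> h(1)])
    also have "\<dots> = (1 + \<delta>) * (1 - \<psi> h / M)"
      using \<open>0 < M\<close> by (simp add: field_simps)
    also have "(\<lambda>x. (1 + \<delta>) + (- (1 + \<delta>) / M) * h x) = (\<lambda>x. (1 + \<delta>) * (1 - h x / M))"
      using \<open>0 < M\<close> by (auto simp: field_simps)
    finally show "\<psi> (\<lambda>x. (1 + \<delta>) * (1 - h x / M)) \<le> (1 + \<delta>) * (1 - \<psi> h / M)"
      by simp
  qed
  then have "outer_mean S \<psi> E \<le> (1 - \<psi> h / M) + \<delta>" if "0 < \<delta>" for \<delta>
  proof -
    have "0 \<le> \<psi> h"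
      using \<psi> h unfolding mean_on_def by blast
    then have "\<delta> * (1 - \<psi> h / M) \<le> \<delta> * 1"
      using \<open>0 < M\<close> that by (intro mult_left_mono) auto
    then show ?thesis
      using \<open>\<And>\<delta>. 0 < \<delta> \<Longrightarrow> outer_mean S \<psi> E \<le> (1 + \<delta>) * (1 - \<psi> h / M)\<close>[OF that]
      by (simp add: distrib_right)
  qed
  then have "outer_mean S \<psi> E \<le> 1 - \<psi> h / M"
    by (rule field_le_epsilon)
  then show ?thesis
    using \<open>0 < M\<close> by (simp add: field_simps)
qed

end

section \<open>Paths and their patterns\<close>

text \<open>
  If \<open>v\<close> took different values at the \<open>i\<close>-th coordinates of \<open>p\<close> and \<open>q\<close>, exchange that coordinate of \<open>q\<close> for
  the one of \<open>p\<close>. At the new point \<open>y\<close> the sum of the \<open>v j\<close> is not \<open>0\<close>, so adding a multiple of \<open>v\<close> to a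
  solution on \<open>P\<close> solves any equation on \<open>P\<close> with \<open>y\<close> added, contrary to fullness.
\<close>
lemma full_kernel_constant:
  fixes P :: "('a ^ 'n::finite) set"
  assumes P: "full P" and v: "\<And>x. x \<in> P \<Longrightarrow> (\<Sum>j\<in>UNIV. v j (x $ j)) = (0::complex)"
    and pq: "p \<in> P" "q \<in> P"
  shows "v i (p $ i) = v i (q $ i)"
proof (rule ccontr)
  assume ne: "v i (p $ i) \<noteq> v i (q $ i)"
  define y where "y = (\<chi> j. if j = i then p $ i else q $ j)"
  define d where "d = v i (p $ i) - v i (q $ i)"
  have "(\<Sum>j\<in>UNIV. v j (y $ j)) = (\<Sum>j\<in>UNIV. v j (q $ j) + (if j = i then d else 0))"
    by (rule sum.cong) (auto simp: y_def d_def)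
  also have "\<dots> = d"
    using v[OF pq(2)] by (simp add: sum.distrib)
  finally have vy: "(\<Sum>j\<in>UNIV. v j (y $ j)) = d" .
  have "d \<noteq> 0"
    using ne by (simp add: d_def)
  then have "y \<notin> P"
    using v vy by metis
  have "good (insert y P)"
    unfolding good_def
  proof
    fix f :: "'a ^ 'n \<Rightarrow> complex"
    obtain u where u: "solves P f u"
      using P unfolding full_def good_def by blast
    define a where "a = (f y - (\<Sum>j\<in>UNIV. u j (y $ j))) / d"
    have "solves (insert y P) f (\<lambda>j z. u j z + a * v j z)"
      unfolding solves_def
    proof
      fix x assume "x \<in> insert y P"
      have "(\<Sum>j\<in>UNIV. u j (x $ j) + a * v j (x $ j)) = (\<Sum>j\<in>UNIV. u j (x $ j)) + a * (\<Sum>j\<in>UNIV. v j (x $ j))"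
        by (simp add: sum.distrib sum_distrib_left)
      also have "\<dots> = f x"
      proof (cases "x = y")
        case True
        then show ?thesis
          using vy \<open>d \<noteq> 0\<close> by (simp add: a_def)
      next
        case False
        then show ?thesis
          using \<open>x \<in> insert y P\<close> u v by (simp add: solves_def)
      qed
      finally show "(\<Sum>j\<in>UNIV. u j (x $ j) + a * v j (x $ j)) = f x" .
    qed
    then show "\<exists>u. solves (insert y P) f u"
      by blast
  qed
  moreover have "insert y P \<subseteq> Omega (\<lambda>j. Proj j P)"
    using pq by (auto simp: Omega_def Proj_def y_def)
  moreover have "P \<subset> insert y P"
    using \<open>y \<notin> P\<close> by blast
  ultimately show False
    using P unfolding full_def by blast
qed

definition linear_form :: "(('x \<Rightarrow> complex) \<Rightarrow> complex) \<Rightarrow> bool" where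
  "linear_form \<phi> \<longleftrightarrow> (\<forall>v w a. \<phi> (\<lambda>x. v x + a * w x) = \<phi> v + a * \<phi> w)"

lemma linear_formD: "linear_form \<phi> \<Longrightarrow> \<phi> (\<lambda>x. v x + a * w x) = \<phi> v + a * \<phi> w"
  unfolding linear_form_def by (elim allE)

text \<open>
  By induction on the number of forms: if the other forms do not suffice, some \<open>w0\<close> in their common
  kernel has \<open>L m w0 \<noteq> 0\<close>, and subtracting from \<open>\<phi>\<close> the multiple of \<open>L m\<close> that agrees with it at \<open>w0\<close>
  leaves a form to which the induction hypothesis applies.
\<close>
lemma linear_form_combination:
  fixes L :: "nat \<Rightarrow> ('x \<Rightarrow> complex) \<Rightarrow> complex"
  assumes L: "\<And>k. k < m \<Longrightarrow> linear_form (L k)" and \<phi>: "linear_form \<phi>"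
    and van: "\<And>w. (\<And>k. k < m \<Longrightarrow> L k w = 0) \<Longrightarrow> \<phi> w = 0"
  shows "\<exists>c. \<forall>w. \<phi> w = (\<Sum>k<m. c k * L k w)"
  using assms
proof (induction m arbitrary: \<phi>)
  case 0
  then show ?case
    by simp
next
  case (Suc m)
  show ?case
  proof (cases "\<forall>w. (\<forall>k<m. L k w = 0) \<longrightarrow> \<phi> w = 0")
    case True
    have "\<exists>c. \<forall>w. \<phi> w = (\<Sum>k<m. c k * L k w)"
    proof (rule Suc.IH)
      show "linear_form (L k)" if "k < m" for k
        using Suc.prems(1) that by simp
      show "\<phi> w = 0" if "\<And>k. k < m \<Longrightarrow> L k w = 0" for w
        using True that by blast
    qed (rule Suc.prems(2))
    then obtain c where c: "\<And>w. \<phi> w = (\<Sum>k<m. c k * L k w)"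
      by blast
    have "\<phi> w = (\<Sum>k<Suc m. (c(m := 0)) k * L k w)" for w
      by (simp add: c[of w])
    then show ?thesis
      by blast
  next
    case False
    then obtain w0 where w0: "\<And>k. k < m \<Longrightarrow> L k w0 = 0" "\<phi> w0 \<noteq> 0"
      by blast
    have Lm: "L m w0 \<noteq> 0"
    proof
      assume "L m w0 = 0"
      then have "\<phi> w0 = 0"
        using w0(1) by (intro Suc.prems(3)) (auto simp: less_Suc_eq)
      with w0 show False by simp
    qed
    have linL: "linear_form (L k)" if "k \<le> m" for k
      using Suc.prems(1) that by simp
    define a where "a = \<phi> w0 / L m w0"
    have "\<exists>c. \<forall>w. \<phi> w - a * L m w = (\<Sum>k<m. c k * L k w)"
    proof (rule Suc.IH)
      show "linear_form (L k)" if "k < m" for k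
        using linL that by simp
      show "linear_form (\<lambda>w. \<phi> w - a * L m w)"
        unfolding linear_form_def
        by (simp only: linear_formD[OF Suc.prems(2)] linear_formD[OF linL[OF order.refl]]) (simp add: algebra_simps)
      fix w assume w: "\<And>k. k < m \<Longrightarrow> L k w = 0"
      define t where "t = - (L m w / L m w0)"
      have "\<phi> (\<lambda>x. w x + t * w0 x) = 0"
      proof (rule Suc.prems(3))
        fix k assume k: "k < Suc m"
        have "L k (\<lambda>x. w x + t * w0 x) = L k w + t * L k w0"
          using k by (intro linear_formD linL) simp
        also have "\<dots> = 0"
          using k w w0(1) Lm by (cases "k = m") (simp_all add: t_def)
        finally show "L k (\<lambda>x. w x + t * w0 x) = 0" .
      qed
      moreover have "\<phi> (\<lambda>x. w x + t * w0 x) = \<phi> w + t * \<phi> w0"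
        by (rule linear_formD[OF Suc.prems(2)])
      ultimately show "\<phi> w - a * L m w = 0"
        using Lm by (simp add: t_def a_def field_simps)
    qed
    then obtain c where c: "\<And>w. \<phi> w - a * L m w = (\<Sum>k<m. c k * L k w)"
      by blast
    have "\<phi> w = (\<Sum>k<Suc m. (c(m := a)) k * L k w)" for w
      using c[of w] by (simp add: algebra_simps)
    then show ?thesis
      by blast
  qed
qed

text \<open>
  A pattern \<open>e\<close> describes coincidences in a sequence \<open>p\<close> of points: \<open>p k\<close> has the same \<open>j\<close>-th coordinate
  as \<open>p (e j k)\<close>. The value \<open>0\<close> for \<open>k \<ge> N\<close> fits sequences that are constantly \<open>p 0\<close> from \<open>N\<close> on.
\<close>
definition patterns :: "nat \<Rightarrow> ('n::finite \<Rightarrow> nat \<Rightarrow> nat) set" where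
  "patterns N = {e. \<forall>j k. (k < N \<longrightarrow> e j k < N) \<and> (N \<le> k \<longrightarrow> e j k = 0)}"

text \<open>
  The coefficients \<open>c\<close> express \<open>w i\<close> at the \<open>i\<close>-th coordinate of the point number \<open>1\<close>, relative to the
  point number \<open>0\<close>, by the sums of \<open>w\<close> at the points. They are required to do so for functions \<open>w\<close> of
  the indices, so that they refer to the pattern and not to the points.
\<close>
definition determines :: "nat \<Rightarrow> ('n::finite \<Rightarrow> nat \<Rightarrow> nat) \<Rightarrow> 'n \<Rightarrow> (nat \<Rightarrow> complex) \<Rightarrow> bool" where
  "determines N e i c \<longleftrightarrow> (\<forall>w :: 'n \<Rightarrow> nat \<Rightarrow> complex.
     w i (e i 1) - w i (e i 0) = (\<Sum>k<N. c k * (\<Sum>j\<in>UNIV. w j (e j k))))"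

lemma finite_patterns: "finite (patterns N :: ('n::finite \<Rightarrow> nat \<Rightarrow> nat) set)"
proof -
  let ?T = "{f :: 'n \<times> nat \<Rightarrow> nat. \<forall>x. (x \<in> UNIV \<times> {..<N} \<longrightarrow> f x \<in> {..<N}) \<and> (x \<notin> UNIV \<times> {..<N} \<longrightarrow> f x = 0)}"
  have "finite ?T"
    by (rule finite_set_of_finite_funs) auto
  then have "finite (curry ` ?T)"
    by (rule finite_imageI)
  moreover have "(patterns N :: ('n \<Rightarrow> nat \<Rightarrow> nat) set) \<subseteq> curry ` ?T"
  proof
    fix e :: "'n \<Rightarrow> nat \<Rightarrow> nat" assume "e \<in> patterns N"
    then have "case_prod e \<in> ?T"
      by (auto simp: patterns_def)
    then have "curry (case_prod e) \<in> curry ` ?T"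
      by (rule imageI)
    then show "e \<in> curry ` ?T"
      by simp
  qed
  ultimately show ?thesis
    using finite_subset by blast
qed

text \<open>
  The points of a path from \<open>b\<close> to \<open>x\<close> are listed with \<open>b\<close> and \<open>x\<close> in front, which costs two more places
  than \<open>card P\<close>; each coordinate is labelled by the first index at which it occurs. Functions of the
  labels are functions of the coordinates, so that \<open>full_kernel_constant\<close> says that the difference of
  the values at \<open>x $ i\<close> and \<open>b $ i\<close> vanishes on the common kernel of the sums at the points of \<open>P\<close>.
\<close>
lemma path_pattern:
  fixes P :: "('a ^ 'n::finite) set"
  assumes P: "finite P" "full P" and card: "card P + 2 \<le> N" and xb: "x \<in> P" "b \<in> P"
  obtains p e where "range p \<subseteq> P" "p 0 = b" "p 1 = x" "\<And>k. N \<le> k \<Longrightarrow> p k = b"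
    "e \<in> patterns N" "\<And>j k. p (e j k) $ j = p k $ j" "\<And>i. \<exists>c. determines N e i c"
proof -
  obtain h where h: "bij_betw h {..<card P} P"
    using ex_bij_betw_nat_finite[OF P(1)] by (auto simp: atLeast0LessThan)
  define p where "p k = (if k = 1 then x else if 2 \<le> k \<and> k < card P + 2 then h (k - 2) else b)" for k :: nat
  have range: "range p \<subseteq> P"
    using h xb by (auto simp: p_def bij_betw_def)
  have onto: "\<exists>k<N. p k = y" if "y \<in> P" for y
  proof -
    have "y \<in> h ` {..<card P}"
      using h \<open>y \<in> P\<close> by (simp add: bij_betw_def)
    then obtain l where "l < card P" "h l = y"
      by blast
    then have "p (l + 2) = y" "l + 2 < N"
      using card by (auto simp: p_def)
    then show ?thesis by blast
  qed
  define e where "e j k = (LEAST k'. p k' $ j = p k $ j)" for j k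
  have e: "p (e j k) $ j = p k $ j" for j k
    unfolding e_def by (rule LeastI[of _ k]) simp
  have e_le: "e j k \<le> k" for j k
    unfolding e_def by (rule Least_le) simp
  have p_ge: "p k = b" if "N \<le> k" for k
    using that card by (auto simp: p_def)
  have "e \<in> patterns N"
  proof -
    have "e j k < N" if "k < N" for j k
      using e_le[of j k] that by linarith
    moreover have "e j k = 0" if "N \<le> k" for j k
    proof -
      have "e j k \<le> 0"
        unfolding e_def by (rule Least_le) (use p_ge[OF that] in \<open>simp add: p_def\<close>)
      then show ?thesis by simp
    qed
    ultimately show ?thesis
      by (simp add: patterns_def)
  qed
  moreover have "\<exists>c. determines N e i c" for i
  proof -
    define L where "L k w = (\<Sum>j\<in>UNIV. w (j, e j k))" for k and w :: "'n \<times> nat \<Rightarrow> complex"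
    have "\<exists>c. \<forall>w. w (i, e i 1) - w (i, e i 0) = (\<Sum>k<N. c k * L k w)"
    proof (rule linear_form_combination)
      show "linear_form (L k)" for k
        unfolding linear_form_def L_def by (simp add: sum.distrib sum_distrib_left)
      show "linear_form (\<lambda>w. w (i, e i 1) - w (i, e i 0))"
        unfolding linear_form_def by (simp add: algebra_simps)
      fix w assume w: "\<And>k. k < N \<Longrightarrow> L k w = 0"
      define v where "v j a = w (j, LEAST k. p k $ j = a)" for j a
      have v: "v j (p k $ j) = w (j, e j k)" for j k
        by (simp add: v_def e_def)
      have "v i (p 1 $ i) = v i (p 0 $ i)"
      proof (rule full_kernel_constant[OF P(2)])
        fix y assume "y \<in> P"
        then obtain k where "k < N" "p k = y"
          using onto by blast
        then show "(\<Sum>j\<in>UNIV. v j (y $ j)) = 0"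
          using w[of k] v by (auto simp: L_def)
      qed (use range in auto)
      then show "w (i, e i 1) - w (i, e i 0) = 0"
        by (simp add: v)
    qed
    then obtain c where c: "\<And>w. w (i, e i 1) - w (i, e i 0) = (\<Sum>k<N. c k * L k w)"
      by blast
    have "determines N e i c"
      unfolding determines_def
    proof
      fix w :: "'n \<Rightarrow> nat \<Rightarrow> complex"
      show "w i (e i 1) - w i (e i 0) = (\<Sum>k<N. c k * (\<Sum>j\<in>UNIV. w j (e j k)))"
        using c[of "case_prod w"] by (simp add: L_def)
    qed
    then show ?thesis
      by blast
  qed
  moreover have "p 0 = b" "p 1 = x"
    by (simp_all add: p_def)
  ultimately show thesis
    using that range e p_ge by blast
qed

section \<open>Points reachable with boundary values in a given set\<close>

text \<open>
  A continuous map from a compact space to a Hausdorff space is a quotient map onto its image.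
\<close>
lemma continuous_on_image_of_compact:
  fixes g :: "'b::t2_space \<Rightarrow> 'c::t2_space" and u :: "'c \<Rightarrow> 'd::topological_space"
  assumes Z: "compact Z" and g: "continuous_on Z g" and ug: "continuous_on Z (\<lambda>z. u (g z))"
  shows "continuous_on (g ` Z) u"
proof -
  have gZ: "closed (g ` Z)"
    using compact_continuous_image[OF g Z] by (rule compact_imp_closed)
  have "closed (u -` T \<inter> g ` Z)" if "closed T" for T
  proof -
    have "closed ((\<lambda>z. u (g z)) -` T \<inter> Z)"
      using ug continuous_on_closed_vimage[OF compact_imp_closed[OF Z]] that by blast
    then have c: "compact (Z \<inter> ((\<lambda>z. u (g z)) -` T \<inter> Z))"
      by (rule compact_Int_closed[OF Z])
    have "compact (g ` (Z \<inter> ((\<lambda>z. u (g z)) -` T \<inter> Z)))"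
      by (rule compact_continuous_image[OF continuous_on_subset[OF g] c]) blast
    moreover have "g ` (Z \<inter> ((\<lambda>z. u (g z)) -` T \<inter> Z)) = u -` T \<inter> g ` Z"
      by blast
    ultimately show ?thesis
      by (metis compact_imp_closed)
  qed
  then show ?thesis
    using continuous_on_closed_vimage[OF gZ] by blast
qed

text \<open>
  The pieces of \<open>F\<close>: the set \<open>S\<close>, labelled \<open>None\<close>, and for each \<open>i\<close> the points that differ from \<open>b\<close> at
  most in coordinate \<open>i\<close> and have that coordinate in \<open>E\<close>. The point \<open>b\<close> belongs to each
  of the latter whatever \<open>E\<close> is, since all paths start at \<open>b\<close>.
\<close>
definition piece :: "('n \<Rightarrow> 'a set) \<Rightarrow> ('a ^ 'n::finite) set \<Rightarrow> ('n \<Rightarrow> 'a) \<Rightarrow> 'a set \<Rightarrow> 'n option \<Rightarrow> ('a ^ 'n) set" where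
  "piece X S b E l = (case l of None \<Rightarrow> S
     | Some i \<Rightarrow> {x. x $ i \<in> insert (b i) (E \<inter> X i) \<and> (\<forall>j. j \<noteq> i \<longrightarrow> x $ j = b j)})"

definition labels :: "nat \<Rightarrow> (nat \<Rightarrow> 'n option) set" where
  "labels N = {\<sigma>. \<forall>k\<ge>N. \<sigma> k = None}"

text \<open>
  Configurations are the sequences of points that a path of the given type (a pattern, and for each
  index the label of a piece) can take. For compact \<open>S\<close>, \<open>X i\<close> and \<open>E\<close> all
  conditions are closed: limits of paths, in which further coordinates may coincide, are again
  configurations of the same type.
\<close>
definition conf :: "('n \<Rightarrow> 'a set) \<Rightarrow> ('a ^ 'n::finite) set \<Rightarrow> ('n \<Rightarrow> 'a) \<Rightarrow> nat \<Rightarrow> 'a set \<Rightarrow>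
    ('n \<Rightarrow> nat \<Rightarrow> nat) \<times> (nat \<Rightarrow> 'n option) \<Rightarrow> (nat \<Rightarrow> 'a ^ 'n) set" where
  "conf X S b N E t = {p. p 0 = (\<chi> j. b j) \<and> (\<forall>k\<ge>N. p k = (\<chi> j. b j)) \<and>
     (\<forall>j k. p (fst t j k) $ j = p k $ j) \<and> (\<forall>k<N. p k \<in> piece X S b E (snd t k)) \<and> p 1 \<in> S}"

definition path_types :: "nat \<Rightarrow> (('n::finite \<Rightarrow> nat \<Rightarrow> nat) \<times> (nat \<Rightarrow> 'n option)) set" where
  "path_types N = {e \<in> patterns N. \<forall>i. \<exists>c. determines N e i c} \<times> labels N"

text \<open>
  For \<open>E = B\<close> this contains every point of \<open>S\<close> that is joined to \<open>b\<close> by a path in \<open>F\<close> with at most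
  \<open>N - 2\<close> points; a smaller \<open>E\<close> restricts the boundary values that may be used on the way.
\<close>
definition reach :: "('n \<Rightarrow> 'a set) \<Rightarrow> ('a ^ 'n::finite) set \<Rightarrow> ('n \<Rightarrow> 'a) \<Rightarrow> nat \<Rightarrow> 'a set \<Rightarrow> ('a ^ 'n) set" where
  "reach X S b N E = (\<lambda>p. p 1) ` (\<Union>t\<in>path_types N. conf X S b N E t)"

definition coef :: "('n::finite \<Rightarrow> nat \<Rightarrow> nat) \<times> (nat \<Rightarrow> 'n option) \<Rightarrow> nat \<Rightarrow> 'n \<Rightarrow> nat \<Rightarrow> complex" where
  "coef t N i = (SOME c. determines N (fst t) i c)"

definition coef_bound :: "nat \<Rightarrow> 'n::finite \<Rightarrow> real" where
  "coef_bound N i = (\<Sum>t\<in>path_types N. \<Sum>k<N. norm (coef t N i k))"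

lemma coef_bound_nonneg: "0 \<le> coef_bound N i"
  unfolding coef_bound_def by (intro sum_nonneg norm_ge_zero)

lemma finite_path_types: "finite (path_types N :: (('n::finite \<Rightarrow> nat \<Rightarrow> nat) \<times> (nat \<Rightarrow> 'n option)) set)"
proof -
  have "labels N = {\<sigma> :: nat \<Rightarrow> 'n option. \<forall>k. (k \<in> {..<N} \<longrightarrow> \<sigma> k \<in> UNIV) \<and> (k \<notin> {..<N} \<longrightarrow> \<sigma> k = None)}"
    by (auto simp: labels_def)
  moreover have "finite \<dots>"
    by (rule finite_set_of_finite_funs) auto
  ultimately have "finite (labels N :: (nat \<Rightarrow> 'n option) set)"
    by simp
  moreover have "finite {e \<in> patterns N. \<forall>i :: 'n. \<exists>c. determines N e i c}"
    by (rule finite_subset[OF _ finite_patterns]) blast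
  ultimately show ?thesis
    unfolding path_types_def by (intro finite_cartesian_product)
qed

lemma continuous_on_coord:
  "continuous_on Z (\<lambda>p :: nat \<Rightarrow> 'a::topological_space ^ 'n::finite. p k)"
  "continuous_on Z (\<lambda>p :: nat \<Rightarrow> 'a::topological_space ^ 'n::finite. p k $ j)"
proof -
  show *: "continuous_on Z (\<lambda>p :: nat \<Rightarrow> 'a ^ 'n. p k)"
    by (rule continuous_on_subset[OF continuous_on_product_coordinates]) simp
  show "continuous_on Z (\<lambda>p :: nat \<Rightarrow> 'a ^ 'n. p k $ j)"
    using * unfolding continuous_on_def by (auto intro: tendsto_vec_nth)
qed

context
  fixes X :: "'n::finite \<Rightarrow> 'a::metric_space set" and S :: "('a ^ 'n) set" and b :: "'n \<Rightarrow> 'a" and N :: nat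
begin

lemma compact_piece:
  assumes "compact S" "\<And>i. compact (X i)" "compact K"
  shows "compact (piece X S b K l)"
proof (cases l)
  case None
  then show ?thesis
    using assms by (simp add: piece_def)
next
  case (Some i)
  have "compact (insert (b i) (K \<inter> X i))"
    using compact_Int_closed[OF assms(3) compact_imp_closed[OF assms(2)]] by simp
  moreover have "continuous_on (insert (b i) (K \<inter> X i)) (\<lambda>a. \<chi> j. if j = i then a else b j)"
  proof (rule continuous_on_vec_lambda)
    show "continuous_on (insert (b i) (K \<inter> X i)) (\<lambda>a. if j = i then a else b j)" for j
      by (cases "j = i") simp_all
  qed
  ultimately have "compact ((\<lambda>a. \<chi> j. if j = i then a else b j) ` insert (b i) (K \<inter> X i))"
    by (intro compact_continuous_image)
  moreover have "piece X S b K l = (\<lambda>a. \<chi> j. if j = i then a else b j) ` insert (b i) (K \<inter> X i)"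
    (is "_ = ?f ` _")
  proof (intro set_eqI iffI)
    fix x assume "x \<in> piece X S b K l"
    then have "x $ i \<in> insert (b i) (K \<inter> X i)" "\<And>j. j \<noteq> i \<Longrightarrow> x $ j = b j"
      by (simp_all add: piece_def Some)
    moreover from this(2) have "x = ?f (x $ i)"
      by (simp add: vec_eq_iff)
    ultimately show "x \<in> ?f ` insert (b i) (K \<inter> X i)"
      by (intro image_eqI[of x ?f "x $ i"])
  next
    fix x assume "x \<in> ?f ` insert (b i) (K \<inter> X i)"
    then obtain a where "a \<in> insert (b i) (K \<inter> X i)" "x = ?f a"
      by (elim imageE)
    then show "x \<in> piece X S b K l"
      by (simp add: piece_def Some)
  qed
  ultimately show ?thesis
    by simp
qed

lemma compact_conf:
  assumes "compact S" "\<And>i. compact (X i)" "compact K"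
  shows "compact (conf X S b N K t)"
proof -
  let ?b = "\<chi> j. b j"
  let ?Q = "PiE UNIV (\<lambda>k. if k < N then piece X S b K (snd t k) else {?b})"
  have "compactin (product_topology (\<lambda>k. euclidean) UNIV) ?Q"
    using compact_piece[OF assms] by (subst compactin_PiE) simp
  then have Q: "compact ?Q"
    by (simp add: euclidean_product_topology)
  let ?C = "{p. p 0 = ?b} \<inter> (\<Inter>j. \<Inter>k. {p. p (fst t j k) $ j = p k $ j}) \<inter> ((\<lambda>p. p 1) -` S)"
  have "closed ?C"
    by (intro closed_Int closed_INT ballI closed_Collect_eq continuous_on_coord continuous_on_const
        closed_vimage compact_imp_closed assms(1))
  then have "compact (?Q \<inter> ?C)"
    by (rule compact_Int_closed[OF Q])
  moreover have "conf X S b N K t = ?Q \<inter> ?C"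
  proof (intro set_eqI iffI)
    fix p assume "p \<in> conf X S b N K t"
    then show "p \<in> ?Q \<inter> ?C"
      by (simp add: conf_def PiE_iff)
  next
    fix p assume p: "p \<in> ?Q \<inter> ?C"
    then have *: "p k \<in> (if k < N then piece X S b K (snd t k) else {?b})" for k
      by blast
    have "p k \<in> piece X S b K (snd t k)" if "k < N" for k
      using *[of k] that by simp
    moreover have "p k = ?b" if "N \<le> k" for k
      using *[of k] that by simp
    ultimately show "p \<in> conf X S b N K t"
      using p unfolding conf_def by simp
  qed
  ultimately show ?thesis
    by simp
qed

lemma piece_mono: "E \<subseteq> E' \<Longrightarrow> piece X S b E l \<subseteq> piece X S b E' l"
  by (auto simp: piece_def split: option.splits)

lemma conf_mono: "E \<subseteq> E' \<Longrightarrow> conf X S b N E t \<subseteq> conf X S b N E' t"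
  unfolding conf_def using subsetD[OF piece_mono] by (simp add: subset_iff)

lemma reach_mono: "E \<subseteq> E' \<Longrightarrow> reach X S b N E \<subseteq> reach X S b N E'"
  unfolding reach_def by (intro image_mono UN_mono conf_mono order.refl)

lemma reach_subset: "reach X S b N E \<subseteq> S"
  unfolding reach_def conf_def by blast

text \<open>
  A configuration uses only finitely many elements of the union.
\<close>
lemma reach_incseq_Union:
  assumes "incseq E"
  shows "reach X S b N (\<Union>n. E n) = (\<Union>n::nat. reach X S b N (E n))"
proof
  show "(\<Union>n. reach X S b N (E n)) \<subseteq> reach X S b N (\<Union>n. E n)"
    by (intro UN_least reach_mono) blast
  show "reach X S b N (\<Union>n. E n) \<subseteq> (\<Union>n. reach X S b N (E n))"
  proof
    fix x assume "x \<in> reach X S b N (\<Union>n. E n)"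
    then obtain p t where p: "t \<in> path_types N" "p \<in> conf X S b N (\<Union>n. E n) t" "x = p 1"
      unfolding reach_def by blast
    have "\<exists>n. p k \<in> piece X S b (E n) (snd t k)" if "k < N" for k
    proof -
      have "p k \<in> piece X S b (\<Union>n. E n) (snd t k)"
        using p(2) that by (simp add: conf_def)
      then show ?thesis
        by (cases "snd t k") (auto simp: piece_def)
    qed
    then have "\<forall>k. \<exists>n. k < N \<longrightarrow> p k \<in> piece X S b (E n) (snd t k)"
      by blast
    from choice[OF this] obtain n where
      n: "\<And>k. k < N \<Longrightarrow> p k \<in> piece X S b (E (n k)) (snd t k)"
      by blast
    define m where "m = Max (insert 0 (n ` {..<N}))"
    have "p k \<in> piece X S b (E m) (snd t k)" if "k < N" for k
    proof -
      have "n k \<le> m"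
        unfolding m_def using that by (intro Max_ge) auto
      then have "E (n k) \<subseteq> E m"
        using assms by (simp add: incseqD)
      then show ?thesis
        by (rule subsetD[OF piece_mono n[OF that]])
    qed
    then have "p \<in> conf X S b N (E m) t"
      using p(2) by (simp add: conf_def)
    then show "x \<in> (\<Union>n. reach X S b N (E n))"
      using p unfolding reach_def by blast
  qed
qed

lemma compact_confs:
  assumes "compact S" "\<And>i. compact (X i)" "compact K"
  shows "compact (\<Union>t\<in>path_types N. conf X S b N K t)"
  using finite_path_types compact_conf[OF assms] by (intro compact_UN) auto

lemma compact_reach:
  assumes "compact S" "\<And>i. compact (X i)" "compact K"
  shows "compact (reach X S b N K)"
  unfolding reach_def by (rule compact_continuous_image[OF continuous_on_coord(1) compact_confs[OF assms]])

text \<open>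
  There are finitely many types, so one and the same type serves for all \<open>K n\<close>; the configurations of
  this type that end at \<open>x\<close> form a decreasing sequence of nonempty compact sets.
\<close>
lemma reach_decseq_Inter:
  assumes c: "compact S" "\<And>i. compact (X i)" and K: "decseq K" "\<And>n. compact (K n)"
  shows "reach X S b N (\<Inter>n. K n) = (\<Inter>n::nat. reach X S b N (K n))"
proof
  show "reach X S b N (\<Inter>n. K n) \<subseteq> (\<Inter>n. reach X S b N (K n))"
    by (intro INT_greatest reach_mono) blast
  show "(\<Inter>n. reach X S b N (K n)) \<subseteq> reach X S b N (\<Inter>n. K n)"
  proof
    fix x assume x: "x \<in> (\<Inter>n. reach X S b N (K n))"
    define C where "C n t = conf X S b N (K n) t \<inter> {p. p 1 = x}" for n t
    have "\<exists>t\<in>path_types N. \<forall>n. C n t \<noteq> {}"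
    proof (rule ccontr)
      assume "\<not> ?thesis"
      then have "\<forall>t\<in>path_types N. \<exists>n. C n t = {}"
        by blast
      from bchoice[OF this] obtain n where n: "\<And>t. t \<in> path_types N \<Longrightarrow> C (n t) t = {}"
        by blast
      define m where "m = Max (insert 0 (n ` path_types N))"
      have "C m t = {}" if "t \<in> path_types N" for t
      proof -
        have "n t \<le> m"
          unfolding m_def using that by (intro Max_ge) (auto simp: finite_path_types)
        then have "K m \<subseteq> K (n t)"
          using K(1) by (simp add: decseqD)
        then show ?thesis
          using conf_mono[of "K m" "K (n t)" t] n[OF that] unfolding C_def by blast
      qed
      moreover have "x \<in> reach X S b N (K m)"
        using x by blast
      ultimately show False
        unfolding reach_def C_def by blast
    qed
    then obtain t where t: "t \<in> path_types N" "\<And>n. C n t \<noteq> {}"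
      by blast
    have "compact (C n t)" for n
      unfolding C_def
      by (intro compact_Int_closed compact_conf c K(2) closed_Collect_eq continuous_on_coord continuous_on_const)
    moreover have "decseq (\<lambda>n. C n t)"
      unfolding decseq_def C_def
      by (intro allI impI Int_mono conf_mono order.refl decseqD[OF K(1)])
    ultimately have "(\<Inter>n. C n t) \<noteq> {}"
      using t(2) by (intro decseq_compact_Inter_nonempty)
    then obtain p where p: "\<And>n. p \<in> C n t"
      by blast
    have "p k \<in> piece X S b (\<Inter>n. K n) (snd t k)" if "k < N" for k
    proof -
      have "p k \<in> piece X S b (K n) (snd t k)" for n
        using p[of n] that by (simp add: C_def conf_def)
      then show ?thesis
        by (cases "snd t k") (auto simp: piece_def)
    qed
    then have "p \<in> conf X S b N (\<Inter>n. K n) t"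
      using p[of 0] by (auto simp: C_def conf_def)
    moreover have "p 1 = x"
      using p[of 0] unfolding C_def by blast
    ultimately have "p \<in> conf X S b N (\<Inter>n. K n) t" "p 1 = x" .
    then show "x \<in> reach X S b N (\<Inter>n. K n)"
      unfolding reach_def using t(1) by blast
  qed
qed

text \<open>
  The sums \<open>\<Sum>j. u j (p k $ j)\<close> are \<open>f (p k)\<close> on \<open>S\<close> and \<open>0\<close> on the other pieces, where all coordinates lie
  in \<open>B\<close>.
\<close>
lemma solution_on_conf:
  assumes u: "solves S f u" "\<And>i a. a \<in> B \<inter> X i \<Longrightarrow> u i a = 0" and b: "\<And>i. b i \<in> B \<inter> X i"
    and t: "t \<in> path_types N" and p: "p \<in> conf X S b N B t"
  shows "u i (p 1 $ i) = (\<Sum>k<N. coef t N i k * (if snd t k = None then f (p k) else 0))"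
proof -
  have "\<exists>c. determines N (fst t) i c"
    using t by (auto simp: path_types_def)
  then have det: "determines N (fst t) i (coef t N i)"
    unfolding coef_def by (rule someI_ex)
  have "p (fst t j k) $ j = p k $ j" for j k
    using p by (simp add: conf_def)
  with det[unfolded determines_def, THEN spec, of "\<lambda>j k. u j (p k $ j)"]
  have "u i (p 1 $ i) - u i (p 0 $ i) = (\<Sum>k<N. coef t N i k * (\<Sum>j\<in>UNIV. u j (p k $ j)))"
    by simp
  also have "\<dots> = (\<Sum>k<N. coef t N i k * (if snd t k = None then f (p k) else 0))"
  proof (intro sum.cong refl arg_cong2[where f = times])
    fix k assume "k \<in> {..<N}"
    then have pk: "p k \<in> piece X S b B (snd t k)"
      using p by (simp add: conf_def)
    show "(\<Sum>j\<in>UNIV. u j (p k $ j)) = (if snd t k = None then f (p k) else 0)"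
    proof (cases "snd t k")
      case None
      then show ?thesis
        using pk u(1) by (simp add: piece_def solves_def)
    next
      case (Some l)
      then have "p k $ l \<in> insert (b l) (B \<inter> X l)" "\<And>j. j \<noteq> l \<Longrightarrow> p k $ j = b j"
        using pk by (simp_all add: piece_def)
      then have "p k $ j \<in> B \<inter> X j" for j
        using b by (cases "j = l") auto
      then have "u j (p k $ j) = 0" for j
        by (rule u(2))
      then show ?thesis
        by (simp add: Some)
    qed
  qed
  also have "u i (p 0 $ i) = 0"
    using p b u(2)[OF b] by (simp add: conf_def)
  finally show ?thesis
    by simp
qed

lemma solution_bounded_on_reach:
  assumes u: "solves S f u" "\<And>i a. a \<in> B \<inter> X i \<Longrightarrow> u i a = 0" and b: "\<And>i. b i \<in> B \<inter> X i"
    and x: "x \<in> reach X S b N B" and f: "\<And>y. y \<in> S \<Longrightarrow> norm (f y) \<le> r" and "0 \<le> r"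
  shows "norm (u i (x $ i)) \<le> coef_bound N i * r"
proof -
  obtain t p where t: "t \<in> path_types N" and p: "p \<in> conf X S b N B t" "x = p 1"
    using x unfolding reach_def by blast
  have "u i (x $ i) = (\<Sum>k<N. coef t N i k * (if snd t k = None then f (p k) else 0))"
    unfolding p(2) by (rule solution_on_conf[OF u b t p(1)])
  also have "norm \<dots> \<le> (\<Sum>k<N. norm (coef t N i k) * r)"
  proof (rule sum_norm_le)
    fix k assume "k \<in> {..<N}"
    then have pk: "p k \<in> piece X S b B (snd t k)"
      using p by (simp add: conf_def)
    have "norm (if snd t k = None then f (p k) else 0) \<le> r"
      using pk f \<open>0 \<le> r\<close> by (cases "snd t k") (simp_all add: piece_def)
    then show "norm (coef t N i k * (if snd t k = None then f (p k) else 0)) \<le> norm (coef t N i k) * r"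
      unfolding norm_mult by (intro mult_left_mono) auto
  qed
  also have "\<dots> = (\<Sum>k<N. norm (coef t N i k)) * r"
    by (simp add: sum_distrib_right)
  also have "\<dots> \<le> coef_bound N i * r"
  proof (rule mult_right_mono[OF _ \<open>0 \<le> r\<close>])
    show "(\<Sum>k<N. norm (coef t N i k)) \<le> coef_bound N i"
      unfolding coef_bound_def
      by (rule member_le_sum[of t "path_types N" "\<lambda>t. \<Sum>k<N. norm (coef t N i k)"])
        (simp_all add: t finite_path_types sum_nonneg)
  qed
  finally show ?thesis .
qed

text \<open>
  The function that assigns to a configuration the value of \<open>u i\<close> at the \<open>i\<close>-th coordinate of its endpoint
  is continuous, since it is given by one continuous formula on each of finitely many compact sets.
  It factors through the projection to that coordinate.
\<close>
lemma solution_continuous_on_reach: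
  assumes c: "compact S" "\<And>i. compact (X i)" and K: "compact K" "K \<subseteq> B"
    and u: "solves S f u" "\<And>i a. a \<in> B \<inter> X i \<Longrightarrow> u i a = 0" and b: "\<And>i. b i \<in> B \<inter> X i"
    and f: "continuous_on S f"
  shows "continuous_on ((\<lambda>x. x $ i) ` reach X S b N K) (u i)"
proof -
  let ?Z = "\<Union>t\<in>path_types N. conf X S b N K t"
  have "continuous_on (conf X S b N K t) (\<lambda>p. u i (p 1 $ i))" if t: "t \<in> path_types N" for t
  proof -
    have "continuous_on (conf X S b N K t) (\<lambda>p. if snd t k = None then f (p k) else 0)" if "k < N" for k
    proof (cases "snd t k = None")
      case True
      have "(\<lambda>p. p k) ` conf X S b N K t \<subseteq> S"
        using True \<open>k < N\<close> by (auto simp: conf_def piece_def)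
      then have "continuous_on (conf X S b N K t) (\<lambda>p. f (p k))"
        using continuous_on_compose2[OF f continuous_on_coord(1)] by blast
      with True show ?thesis
        by simp
    next
      case False
      then show ?thesis
        by (simp only: if_False continuous_on_const)
    qed
    then have "continuous_on (conf X S b N K t) (\<lambda>p. \<Sum>k<N. coef t N i k * (if snd t k = None then f (p k) else 0))"
      by (intro continuous_on_sum continuous_on_mult continuous_on_const) auto
    moreover have "u i (p 1 $ i) = (\<Sum>k<N. coef t N i k * (if snd t k = None then f (p k) else 0))"
      if "p \<in> conf X S b N K t" for p
      by (rule solution_on_conf[OF u b t subsetD[OF conf_mono[OF K(2)] that]])
    ultimately show ?thesis
      by (simp cong: continuous_on_cong)
  qed
  then have "continuous_on ?Z (\<lambda>p. u i (p 1 $ i))"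
    using compact_conf[OF c K(1)]
    by (intro continuous_on_closed_Union finite_path_types compact_imp_closed) auto
  from continuous_on_image_of_compact[OF compact_confs[OF c K(1)] continuous_on_coord(2) this]
  have "continuous_on ((\<lambda>p. p 1 $ i) ` ?Z) (u i)" .
  moreover have "(\<lambda>p. p 1 $ i) ` ?Z = (\<lambda>x. x $ i) ` reach X S b N K"
    unfolding reach_def by (simp add: image_image)
  ultimately show ?thesis
    by simp
qed

end

section \<open>Approximation by sums of continuous functions\<close>

text \<open>
  Tietze's theorem for the real and the imaginary part; this is where the factor \<open>2\<close> comes from.
\<close>
lemma continuous_extension_complex:
  fixes u :: "'a::metric_space \<Rightarrow> complex"
  assumes K: "closed K" and u: "continuous_on K u" and r: "\<And>x. x \<in> K \<Longrightarrow> norm (u x) \<le> r" "0 \<le> r"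
  shows "\<exists>g. continuous_on UNIV g \<and> (\<forall>x\<in>K. g x = u x) \<and> (\<forall>x. norm (g x) \<le> 2 * r)"
proof -
  have normal: "normal_space (euclidean :: 'a topology)"
    by (intro metrizable_imp_normal_space metrizable_space_euclidean)
  have ext: "\<exists>g. continuous_on UNIV g \<and> (\<forall>x\<in>K. g x = v x) \<and> (\<forall>x. \<bar>g x\<bar> \<le> r)"
    if v: "continuous_on K v" "\<And>x. x \<in> K \<Longrightarrow> \<bar>v x\<bar> \<le> r" for v :: "'a \<Rightarrow> real"
  proof -
    have "continuous_map (subtopology euclidean K) euclideanreal v"
      using v(1) by simp
    moreover have "v ` K \<subseteq> {- r..r}"
      using v(2) by (auto simp: abs_le_iff) (metis minus_le_iff)
    ultimately obtain g where g: "continuous_map euclidean euclideanreal g" "\<And>x. x \<in> K \<Longrightarrow> g x = v x"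
      "g ` topspace (euclidean :: 'a topology) \<subseteq> {- r..r}"
      using Tietze_extension_closed_real_interval[OF normal, of K v "- r" r] K r(2) by auto
    have "\<bar>g x\<bar> \<le> r" for x
    proof -
      have "g x \<in> {- r..r}"
        using g(3) by (simp add: image_subset_iff)
      then show ?thesis by auto
    qed
    then show ?thesis
      using g by auto
  qed
  have "\<exists>g. continuous_on UNIV g \<and> (\<forall>x\<in>K. g x = Re (u x)) \<and> (\<forall>x. \<bar>g x\<bar> \<le> r)"
    using u r(1) by (intro ext continuous_on_Re) (auto intro: order_trans[OF abs_Re_le_cmod])
  then obtain g where g: "continuous_on UNIV g" "\<And>x. x \<in> K \<Longrightarrow> g x = Re (u x)" "\<And>x. \<bar>g x\<bar> \<le> r"
    by blast
  have "\<exists>h. continuous_on UNIV h \<and> (\<forall>x\<in>K. h x = Im (u x)) \<and> (\<forall>x. \<bar>h x\<bar> \<le> r)"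
    using u r(1) by (intro ext continuous_on_Im) (auto intro: order_trans[OF abs_Im_le_cmod])
  then obtain h where h: "continuous_on UNIV h" "\<And>x. x \<in> K \<Longrightarrow> h x = Im (u x)" "\<And>x. \<bar>h x\<bar> \<le> r"
    by blast
  show ?thesis
  proof (intro exI[of _ "\<lambda>x. Complex (g x) (h x)"] conjI ballI allI)
    show "continuous_on UNIV (\<lambda>x. Complex (g x) (h x))"
      unfolding Complex_eq using g(1) h(1) by (intro continuous_intros)
    show "Complex (g x) (h x) = u x" if "x \<in> K" for x
      using g(2) h(2) that by (simp add: complex_eq_iff)
    show "norm (Complex (g x) (h x)) \<le> 2 * r" for x
      using cmod_le[of "Complex (g x) (h x)"] g(3)[of x] h(3)[of x] by simp
  qed
qed

lemma sum_coordinates_continuous: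
  fixes g :: "'n::finite \<Rightarrow> 'a::topological_space \<Rightarrow> complex"
  assumes "\<And>i. continuous_on (X i) (g i)" "\<And>x i. x \<in> S \<Longrightarrow> x $ i \<in> X i"
  shows "continuous_on S (\<lambda>x. \<Sum>i\<in>UNIV. g i (x $ i))"
proof (intro continuous_on_sum)
  fix i
  have "continuous_on S (\<lambda>x :: 'a ^ 'n. x $ i)"
    by (intro continuous_intros)
  then show "continuous_on S (\<lambda>x. g i (x $ i))"
    using continuous_on_compose2[OF assms(1)] assms(2) by blast
qed

text \<open>
  A minimax principle: sums that depend on the mean \<open>\<psi>\<close> can be replaced by one that is good
  everywhere. The functions above a multiple \<open>t * (D g - \<epsilon>)\<close>, where \<open>D g\<close> is the modulus of the error of
  \<open>g\<close>, form a convex cone, because \<open>D\<close> is convex and so is the set of admissible \<open>g\<close>. If every error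
  reached \<open>\<epsilon>\<close> somewhere, a mean would be nonnegative on this cone and hence at least \<open>\<epsilon>\<close> at every \<open>D g\<close>.
\<close>
lemma small_of_small_in_means:
  fixes X :: "'n::finite \<Rightarrow> 'a::metric_space set" and S :: "('a ^ 'n) set" and f :: "'a ^ 'n \<Rightarrow> complex"
  assumes S: "compact S" "S \<noteq> {}" "\<And>x i. x \<in> S \<Longrightarrow> x $ i \<in> X i"
    and f: "continuous_on S f" and "0 < \<epsilon>" and R: "\<And>i. 0 \<le> R i"
    and small: "\<And>\<psi>. mean_on S \<psi> \<Longrightarrow> \<exists>g. (\<forall>i. continuous_on (X i) (g i)) \<and> (\<forall>i. \<forall>a\<in>X i. norm (g i a) \<le> R i) \<and>
        \<psi> (\<lambda>x. norm (f x - (\<Sum>i\<in>UNIV. g i (x $ i)))) < \<epsilon>"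
  shows "\<exists>g. (\<forall>i. continuous_on (X i) (g i)) \<and> (\<forall>i. \<forall>a\<in>X i. norm (g i a) \<le> R i) \<and>
    (\<forall>x\<in>S. norm (f x - (\<Sum>i\<in>UNIV. g i (x $ i))) < \<epsilon>)"
proof (rule ccontr)
  define G where "G = {g :: 'n \<Rightarrow> 'a \<Rightarrow> complex. (\<forall>i. continuous_on (X i) (g i)) \<and> (\<forall>i. \<forall>a\<in>X i. norm (g i a) \<le> R i)}"
  define D where "D g x = norm (f x - (\<Sum>i\<in>UNIV. g i (x $ i)))" for g and x :: "'a ^ 'n"
  define \<Phi> where "\<Phi> = {h. continuous_on S h \<and> (\<exists>t\<ge>0. \<exists>g\<in>G. \<forall>x\<in>S. t * (D g x - \<epsilon>) \<le> h x)}"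
  assume "\<not> ?thesis"
  then have far: "\<exists>x\<in>S. \<epsilon> \<le> D g x" if "g \<in> G" for g
    using that unfolding G_def D_def by (simp add: not_less) blast
  have D_cont: "continuous_on S (D g)" if "g \<in> G" for g
    unfolding D_def using that f S(3)
    by (intro continuous_intros sum_coordinates_continuous[of X]) (simp_all add: G_def)
  have zero: "(\<lambda>i a. 0) \<in> G"
    using R by (simp add: G_def)
  have "\<exists>\<psi>. mean_on S \<psi> \<and> (\<forall>h\<in>\<Phi>. 0 \<le> \<psi> h)"
  proof (rule mean_nonneg_on_cone[OF S(1,2)])
    show "\<Phi> \<subseteq> cont S"
      by (auto simp: \<Phi>_def)
  next
    fix h :: "'a ^ 'n \<Rightarrow> real" assume "continuous_on S h" "\<And>x. x \<in> S \<Longrightarrow> 0 \<le> h x"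
    then have "\<forall>x\<in>S. 0 * (D (\<lambda>i a. 0) x - \<epsilon>) \<le> h x"
      by simp
    then show "h \<in> \<Phi>"
      unfolding \<Phi>_def using zero \<open>continuous_on S h\<close> by blast
  next
    fix h1 h2 assume "h1 \<in> \<Phi>" "h2 \<in> \<Phi>"
    then obtain t1 g1 t2 g2 where 1: "continuous_on S h1" "0 \<le> t1" "g1 \<in> G" "\<And>x. x \<in> S \<Longrightarrow> t1 * (D g1 x - \<epsilon>) \<le> h1 x"
      and 2: "continuous_on S h2" "0 \<le> t2" "g2 \<in> G" "\<And>x. x \<in> S \<Longrightarrow> t2 * (D g2 x - \<epsilon>) \<le> h2 x"
      unfolding \<Phi>_def by blast
    have cont: "continuous_on S (\<lambda>x. h1 x + h2 x)"
      using 1 2 by (intro continuous_intros)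
    have "\<exists>g\<in>G. \<forall>x\<in>S. (t1 + t2) * (D g x - \<epsilon>) \<le> h1 x + h2 x"
    proof (cases "t1 + t2 = 0")
      case True
      then have "t1 = 0" "t2 = 0"
        using 1(2) 2(2) by linarith+
      then have "\<forall>x\<in>S. (t1 + t2) * (D g1 x - \<epsilon>) \<le> h1 x + h2 x"
        using 1(4) 2(4) by fastforce
      then show ?thesis
        using 1(3) by blast
    next
      case False
      define s1 s2 where s: "s1 = t1 / (t1 + t2)" "s2 = t2 / (t1 + t2)"
      have pos: "0 < t1 + t2"
        using False 1(2) 2(2) by linarith
      have s01: "0 \<le> s1" "0 \<le> s2" "s1 + s2 = 1"
        using 1(2) 2(2) pos by (simp_all add: s add_divide_distrib[symmetric])
      define g where "g i a = of_real s1 * g1 i a + of_real s2 * g2 i a" for i a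
      have "g \<in> G"
      proof -
        have "continuous_on (X i) (g i)" for i
          unfolding g_def using 1(3) 2(3) by (intro continuous_intros) (simp_all add: G_def)
        moreover have "norm (g i a) \<le> R i" if "a \<in> X i" for i a
        proof -
          have "norm (g i a) \<le> s1 * norm (g1 i a) + s2 * norm (g2 i a)"
            unfolding g_def by (rule norm_triangle_le) (simp add: norm_mult s01)
          also have "\<dots> \<le> s1 * R i + s2 * R i"
            using 1(3) 2(3) s01 that by (intro add_mono mult_left_mono) (simp_all add: G_def)
          also have "\<dots> = R i"
            using s01(3) by (simp add: distrib_right[symmetric])
          finally show ?thesis .
        qed
        ultimately show ?thesis
          by (simp add: G_def)
      qed
      moreover have "(t1 + t2) * (D g x - \<epsilon>) \<le> h1 x + h2 x" if "x \<in> S" for x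
      proof -
        have "f x - (\<Sum>i\<in>UNIV. g i (x $ i)) = of_real s1 * (f x - (\<Sum>i\<in>UNIV. g1 i (x $ i))) + of_real s2 * (f x - (\<Sum>i\<in>UNIV. g2 i (x $ i)))"
        proof -
          have "f x = of_real (s1 + s2) * f x"
            by (simp add: s01(3))
          then show ?thesis
            unfolding g_def by (simp add: sum.distrib sum_distrib_left algebra_simps)
        qed
        then have "D g x \<le> s1 * D g1 x + s2 * D g2 x"
          unfolding D_def by (simp only:) (rule norm_triangle_le, simp add: norm_mult s01)
        then have "(t1 + t2) * D g x \<le> (t1 + t2) * (s1 * D g1 x + s2 * D g2 x)"
          using pos by (intro mult_left_mono) auto
        also have "\<dots> = t1 * D g1 x + t2 * D g2 x"
          using pos by (simp add: s distrib_left)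
        finally show ?thesis
          using 1(4)[OF that] 2(4)[OF that] by (simp add: algebra_simps)
      qed
      ultimately show ?thesis
        by blast
    qed
    moreover have "0 \<le> t1 + t2"
      using 1(2) 2(2) by simp
    ultimately show "(\<lambda>x. h1 x + h2 x) \<in> \<Phi>"
      unfolding \<Phi>_def using cont by blast
  next
    fix h and s :: real assume h: "h \<in> \<Phi>" and "0 < s"
    then obtain t g where t: "continuous_on S h" "0 \<le> t" "g \<in> G" "\<And>x. x \<in> S \<Longrightarrow> t * (D g x - \<epsilon>) \<le> h x"
      unfolding \<Phi>_def by blast
    have "continuous_on S (\<lambda>x. s * h x)"
      using t by (intro continuous_intros)
    moreover have "\<forall>x\<in>S. (s * t) * (D g x - \<epsilon>) \<le> s * h x"
      using t(4) \<open>0 < s\<close> by (simp add: mult.assoc)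
    moreover have "0 \<le> s * t"
      using t(2) \<open>0 < s\<close> by simp
    ultimately show "(\<lambda>x. s * h x) \<in> \<Phi>"
      unfolding \<Phi>_def using t(3) by blast
  next
    fix h assume "h \<in> \<Phi>"
    then obtain t g where t: "0 \<le> t" "g \<in> G" "\<And>x. x \<in> S \<Longrightarrow> t * (D g x - \<epsilon>) \<le> h x"
      unfolding \<Phi>_def by blast
    obtain x where "x \<in> S" "\<epsilon> \<le> D g x"
      using far[OF t(2)] by blast
    then have "0 \<le> t * (D g x - \<epsilon>)"
      using t(1) by simp
    then show "\<exists>x\<in>S. 0 \<le> h x"
      using t(3)[OF \<open>x \<in> S\<close>] \<open>x \<in> S\<close> by (intro bexI[of _ x]) linarith+
  qed
  then obtain \<psi> where \<psi>: "mean_on S \<psi>" "\<And>h. h \<in> \<Phi> \<Longrightarrow> 0 \<le> \<psi> h"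
    by blast
  obtain g where g: "g \<in> G" "\<psi> (D g) < \<epsilon>"
    using small[OF \<psi>(1)] unfolding G_def D_def by blast
  have c: "continuous_on S (\<lambda>x. D g x + - \<epsilon>)"
    using D_cont[OF g(1)] by (intro continuous_intros)
  have "\<forall>x\<in>S. 1 * (D g x - \<epsilon>) \<le> D g x + - \<epsilon>"
    by simp
  then have "(\<lambda>x. D g x + - \<epsilon>) \<in> \<Phi>"
    unfolding \<Phi>_def using c g(1) zero_le_one by blast
  then have "0 \<le> \<psi> (\<lambda>x. D g x + - \<epsilon>)"
    by (rule \<psi>(2))
  also have "\<dots> = \<psi> (D g) + \<psi> (\<lambda>x. - \<epsilon>)"
    by (rule mean_on_add[OF \<psi>(1) D_cont[OF g(1)]]) simp
  also have "\<dots> = \<psi> (D g) - \<epsilon>"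
    by (simp add: mean_on_const[OF \<psi>(1)])
  finally show False
    using g(2) by simp
qed

text \<open>
  For a mean \<open>\<psi>\<close>, the solution \<open>u\<close> is continuous on the projections of \<open>reach K\<close> for a compact \<open>K \<subseteq> B\<close>
  such that \<open>reach K\<close> has outer mean at least \<open>\<rho>\<close>. Continuous extensions of it have no error there,
  and elsewhere the error is at most \<open>M\<close>. The threshold \<open>\<rho>\<close> is such that \<open>M * (1 - \<rho>) = \<epsilon> / 2\<close>.
\<close>
lemma approximation_by_continuous_sums:
  fixes X :: "'n::finite \<Rightarrow> 'a::metric_space set" and S :: "('a ^ 'n) set" and f :: "'a ^ 'n \<Rightarrow> complex"
  assumes S: "compact S" "S \<noteq> {}" "\<And>x i. x \<in> S \<Longrightarrow> x $ i \<in> X i" and X: "\<And>i. compact (X i)"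
    and B: "B \<in> sets borel" "B \<subseteq> Y" "compact Y" and b: "\<And>i. b i \<in> B \<inter> X i"
    and u: "solves S f u" "\<And>i a. a \<in> B \<inter> X i \<Longrightarrow> u i a = 0"
    and reach: "S \<subseteq> reach X S b N B"
    and f: "continuous_on S f" "\<And>x. x \<in> S \<Longrightarrow> norm (f x) \<le> r" "0 \<le> r" and "0 < \<epsilon>"
  shows "\<exists>g. (\<forall>i. continuous_on (X i) (g i)) \<and> (\<forall>i. \<forall>a\<in>X i. norm (g i a) \<le> 2 * (coef_bound N i * r)) \<and>
    (\<forall>x\<in>S. norm (f x - (\<Sum>i\<in>UNIV. g i (x $ i))) < \<epsilon>)"
proof (rule small_of_small_in_means[OF S f(1) \<open>0 < \<epsilon>\<close>])
  let ?R = "\<lambda>i::'n. 2 * (coef_bound N i * r)"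
  show R: "0 \<le> ?R i" for i
    using coef_bound_nonneg[of N i] f(3) by simp
  fix \<psi> assume \<psi>: "mean_on S \<psi>"
  define M where "M = r + (\<Sum>i\<in>UNIV. ?R i) + 1"
  have "0 \<le> (\<Sum>i\<in>UNIV. ?R i)"
    by (rule sum_nonneg) (rule R)
  then have "0 < M"
    unfolding M_def using f(3) by linarith
  define \<rho> where "\<rho> = 1 - \<epsilon> / (2 * M)"
  define c where "c E = outer_mean S \<psi> (reach X S b N E)" for E
  have "\<exists>K\<subseteq>B. compact K \<and> \<rho> \<le> c K"
  proof (rule capacitable_borel[OF B])
    have "1 \<le> c S'" if "S \<subseteq> reach X S b N S'" for S'
      unfolding c_def using outer_mean_space[OF \<psi> S(1)] outer_mean_mono[OF \<psi> that] by linarith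
    then have "1 \<le> c B"
      using reach by blast
    moreover have "\<rho> < 1"
      using \<open>0 < M\<close> \<open>0 < \<epsilon>\<close> by (simp add: \<rho>_def)
    ultimately show "\<rho> < c B"
      by linarith
  next
    show "c E \<le> c E'" if "E \<subseteq> E'" for E E'
      unfolding c_def by (intro outer_mean_mono[OF \<psi>] reach_mono that)
  next
    fix E :: "nat \<Rightarrow> 'a set" assume E: "incseq E" "\<rho> < c (\<Union>n. E n)"
    show "\<exists>n. \<rho> < c (E n)"
    proof (rule ccontr)
      assume "\<nexists>n. \<rho> < c (E n)"
      then have le: "c (E n) \<le> \<rho>" for n
        by (meson not_less)
      have "outer_mean S \<psi> (\<Union>n. reach X S b N (E n)) \<le> \<rho>"
      proof (rule outer_mean_Union_le[OF \<psi>])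
        show "incseq (\<lambda>n. reach X S b N (E n))"
          unfolding incseq_def by (intro allI impI reach_mono incseqD[OF E(1)])
        show "outer_mean S \<psi> (reach X S b N (E n)) \<le> \<rho>" for n
          using le[of n] by (simp add: c_def)
      qed (rule reach_subset)
      then show False
        using E(2) by (simp add: c_def reach_incseq_Union[OF E(1)])
    qed
  next
    fix K :: "nat \<Rightarrow> 'a set" assume K: "decseq K" "\<And>n. compact (K n)" "\<And>n. \<rho> \<le> c (K n)"
    have "\<rho> \<le> outer_mean S \<psi> (\<Inter>n. reach X S b N (K n))"
    proof (rule outer_mean_Inter_ge[OF \<psi>])
      show "decseq (\<lambda>n. reach X S b N (K n))"
        unfolding decseq_def by (intro allI impI reach_mono decseqD[OF K(1)])
      show "compact (reach X S b N (K n))" for n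
        by (rule compact_reach[OF S(1) X K(2)])
      show "\<rho> \<le> outer_mean S \<psi> (reach X S b N (K n))" for n
        using K(3)[of n] by (simp add: c_def)
    qed (rule reach_subset)
    then show "\<rho> \<le> c (\<Inter>n. K n)"
      by (simp add: c_def reach_decseq_Inter[OF S(1) X K(1,2)])
  qed
  then obtain K where K: "K \<subseteq> B" "compact K" "\<rho> \<le> c K"
    by blast
  have "\<exists>h. continuous_on UNIV h \<and> (\<forall>x\<in>reach X S b N K. h (x $ i) = u i (x $ i)) \<and> (\<forall>a. norm (h a) \<le> ?R i)" for i
  proof -
    let ?P = "(\<lambda>x. x $ i) ` reach X S b N K"
    have "compact ?P"
      by (rule compact_continuous_image[OF _ compact_reach[OF S(1) X K(2)]]) (intro continuous_intros)
    then have P: "closed ?P"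
      by (rule compact_imp_closed)
    have u_cont: "continuous_on ?P (u i)"
      by (rule solution_continuous_on_reach[OF S(1) X K(2,1) u b f(1)])
    have u_le: "norm (u i a) \<le> coef_bound N i * r" if "a \<in> ?P" for a
    proof -
      obtain x where x: "x \<in> reach X S b N K" "a = x $ i"
        using \<open>a \<in> ?P\<close> by blast
      show ?thesis
        unfolding x(2) by (rule solution_bounded_on_reach[OF u b subsetD[OF reach_mono[OF K(1)] x(1)] f(2,3)])
    qed
    have r0: "0 \<le> coef_bound N i * r"
      using coef_bound_nonneg[of N i] f(3) by simp
    have "\<exists>h. continuous_on UNIV h \<and> (\<forall>a\<in>?P. h a = u i a) \<and> (\<forall>a. norm (h a) \<le> ?R i)"
      by (rule continuous_extension_complex[OF P u_cont u_le r0])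
    then show ?thesis
      by (simp only: ball_simps)
  qed
  then have "\<forall>i. \<exists>h. continuous_on UNIV h \<and> (\<forall>x\<in>reach X S b N K. h (x $ i) = u i (x $ i)) \<and> (\<forall>a. norm (h a) \<le> ?R i)"
    by blast
  from choice[OF this] obtain g where
    "\<forall>i. continuous_on UNIV (g i) \<and> (\<forall>x\<in>reach X S b N K. g i (x $ i) = u i (x $ i)) \<and> (\<forall>a. norm (g i a) \<le> ?R i)" ..
  then have g: "\<And>i. continuous_on UNIV (g i)" "\<And>i x. x \<in> reach X S b N K \<Longrightarrow> g i (x $ i) = u i (x $ i)"
    "\<And>i a. norm (g i a) \<le> ?R i"
    by blast+
  have gX: "continuous_on (X i) (g i)" for i
    by (rule continuous_on_subset[OF g(1)]) simp
  let ?h = "\<lambda>x. norm (f x - (\<Sum>i\<in>UNIV. g i (x $ i)))"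
  have "\<psi> ?h \<le> M * (1 - outer_mean S \<psi> (reach X S b N K))"
  proof (rule mean_le_outer_mean_compl[OF \<psi>])
    show "continuous_on S ?h"
      by (intro continuous_on_norm continuous_on_diff f(1) sum_coordinates_continuous[of X] gX S(3))
    show "?h x \<le> M" if "x \<in> S" for x
    proof -
      have "?h x \<le> norm (f x) + norm (\<Sum>i\<in>UNIV. g i (x $ i))"
        by (rule norm_triangle_ineq4)
      also have "\<dots> \<le> r + (\<Sum>i\<in>UNIV. ?R i)"
        by (intro add_mono f(2) that sum_norm_le g(3))
      finally show ?thesis
        by (simp add: M_def)
    qed
    show "?h x = 0" if "x \<in> reach X S b N K" for x
    proof -
      have "x \<in> S"
        using that reach_subset by blast
      then show ?thesis
        using u(1) g(2)[OF that] by (simp add: solves_def)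
    qed
  qed (use \<open>0 < M\<close> reach_subset[of X S b N K] in auto)
  also have "\<dots> \<le> M * (1 - \<rho>)"
    using K(3) \<open>0 < M\<close> by (intro mult_left_mono) (simp_all add: c_def)
  also have "\<dots> < \<epsilon>"
    using \<open>0 < M\<close> \<open>0 < \<epsilon>\<close> by (simp add: \<rho>_def)
  finally show "\<exists>g. (\<forall>i. continuous_on (X i) (g i)) \<and> (\<forall>i. \<forall>a\<in>X i. norm (g i a) \<le> ?R i) \<and>
      \<psi> (\<lambda>x. norm (f x - (\<Sum>i\<in>UNIV. g i (x $ i)))) < \<epsilon>"
    using gX g(3) by blast
qed

text \<open>
  The remainders are halved in each step, so that by the bounds \<open>R i * r\<close> the corrections form a
  uniformly convergent series in each \<open>X i\<close>.
\<close>
lemma exact_of_approximate_sums: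
  fixes X :: "'n::finite \<Rightarrow> 'a::topological_space set" and S :: "('a ^ 'n) set" and f :: "'a ^ 'n \<Rightarrow> complex"
  assumes SX: "\<And>x i. x \<in> S \<Longrightarrow> x $ i \<in> X i"
    and step: "\<And>(h :: 'a ^ 'n \<Rightarrow> complex) r. continuous_on S h \<Longrightarrow> (\<And>x. x \<in> S \<Longrightarrow> norm (h x) \<le> r) \<Longrightarrow> 0 < r \<Longrightarrow>
       \<exists>g. (\<forall>i. continuous_on (X i) (g i)) \<and> (\<forall>i. \<forall>a\<in>X i. norm (g i a) \<le> R i * r) \<and>
         (\<forall>x\<in>S. norm (h x - (\<Sum>i\<in>UNIV. g i (x $ i))) \<le> r / 2)"
    and f: "continuous_on S f" and fr: "\<And>x. x \<in> S \<Longrightarrow> norm (f x) \<le> r" and "0 < r"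
  shows "\<exists>v. (\<forall>i. continuous_on (X i) (v i)) \<and> (\<forall>x\<in>S. f x = (\<Sum>i\<in>UNIV. v i (x $ i)))"
proof -
  define P where "P n h \<longleftrightarrow> continuous_on S h \<and> (\<forall>x\<in>S. norm (h x) \<le> r * (1/2) ^ n)"
    for n and h :: "'a ^ 'n \<Rightarrow> complex"
  define Q where "Q n h h' g \<longleftrightarrow> (\<forall>i. continuous_on (X i) (g i)) \<and>
      (\<forall>i. \<forall>a\<in>X i. norm (g i a) \<le> R i * (r * (1/2) ^ n)) \<and>
      (\<forall>x. h' x = h x - (\<Sum>i\<in>UNIV. g i (x $ i)))"
    for n and h h' :: "'a ^ 'n \<Rightarrow> complex" and g :: "'n \<Rightarrow> 'a \<Rightarrow> complex"
  have "\<exists>F. \<forall>n. (P n (F n) \<and> (n = 0 \<longrightarrow> F n = f)) \<and> (\<exists>g. Q n (F n) (F (Suc n)) g)"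
  proof (rule dependent_nat_choice)
    show "\<exists>h. P 0 h \<and> (0 = 0 \<longrightarrow> h = f)"
      using f fr by (simp add: P_def)
  next
    fix h n assume "P n h \<and> (n = 0 \<longrightarrow> h = f)"
    then have h: "continuous_on S h" "\<And>x. x \<in> S \<Longrightarrow> norm (h x) \<le> r * (1/2) ^ n"
      by (simp_all add: P_def)
    have "0 < r * (1/2) ^ n"
      using \<open>0 < r\<close> by simp
    from step[OF h this] obtain g where g: "\<And>i. continuous_on (X i) (g i)"
      "\<And>i a. a \<in> X i \<Longrightarrow> norm (g i a) \<le> R i * (r * (1/2) ^ n)"
      "\<And>x. x \<in> S \<Longrightarrow> norm (h x - (\<Sum>i\<in>UNIV. g i (x $ i))) \<le> r * (1/2) ^ n / 2"
      by blast
    let ?h' = "\<lambda>x. h x - (\<Sum>i\<in>UNIV. g i (x $ i))"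
    have "continuous_on S ?h'"
      by (intro continuous_on_diff h sum_coordinates_continuous[of X] g SX)
    then have "P (Suc n) ?h'"
      using g(3) by (simp add: P_def)
    moreover have "Q n h ?h' g"
      using g by (simp add: Q_def)
    ultimately show "\<exists>h'. (P (Suc n) h' \<and> (Suc n = 0 \<longrightarrow> h' = f)) \<and> (\<exists>g. Q n h h' g)"
      by blast
  qed
  then obtain F where F: "\<And>n. P n (F n)" "F 0 = f" and "\<forall>n. \<exists>g. Q n (F n) (F (Suc n)) g"
    by blast
  from choice[OF this(3)] obtain g where "\<forall>n. Q n (F n) (F (Suc n)) (g n)" ..
  then have g: "\<And>n i. continuous_on (X i) (g n i)"
    "\<And>n i a. a \<in> X i \<Longrightarrow> norm (g n i a) \<le> R i * (r * (1/2) ^ n)"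
    "\<And>n x. F (Suc n) x = F n x - (\<Sum>i\<in>UNIV. g n i (x $ i))"
    unfolding Q_def by blast+
  define v where "v i a = (\<Sum>n. g n i a)" for i a
  have summable: "summable (\<lambda>n. R i * (r * (1/2) ^ n))" for i
    by (intro summable_mult summable_geometric) simp
  have "continuous_on (X i) (v i)" for i
  proof -
    have ul: "uniform_limit (X i) (\<lambda>n a. \<Sum>k<n. g k i a) (v i) sequentially"
      unfolding v_def[abs_def] by (rule Weierstrass_m_test[OF g(2) summable])
    have "\<forall>\<^sub>F n in sequentially. continuous_on (X i) (\<lambda>a. \<Sum>k<n. g k i a)"
      by (intro always_eventually allI continuous_on_sum g)
    from uniform_limit_theorem[OF this ul trivial_limit_sequentially] show ?thesis .
  qed
  moreover have "f x = (\<Sum>i\<in>UNIV. v i (x $ i))" if x: "x \<in> S" for x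
  proof -
    have "summable (\<lambda>n. g n i (x $ i))" for i
      by (rule summable_comparison_test'[OF summable, of 0 _ i]) (rule g(2)[OF SX[OF x]])
    then have "(\<lambda>n. g n i (x $ i)) sums v i (x $ i)" for i
      unfolding v_def by (rule summable_sums)
    then have "(\<lambda>n. \<Sum>i\<in>UNIV. g n i (x $ i)) sums (\<Sum>i\<in>UNIV. v i (x $ i))"
      by (intro sums_sum)
    moreover have "(\<Sum>k<n. \<Sum>i\<in>UNIV. g k i (x $ i)) = f x - F n x" for n
      by (induction n) (simp_all add: F(2) g(3))
    ultimately have "(\<lambda>n. f x - F n x) \<longlonglongrightarrow> (\<Sum>i\<in>UNIV. v i (x $ i))"
      by (simp add: sums_def)
    moreover have "(\<lambda>n. F n x) \<longlonglongrightarrow> 0"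
    proof (rule tendsto_norm_zero_cancel, rule tendsto_sandwich[of "\<lambda>n. 0" _ _ "\<lambda>n. r * (1/2) ^ n"])
      show "\<forall>\<^sub>F n in sequentially. norm (F n x) \<le> r * (1/2) ^ n"
        using F(1) x by (intro always_eventually allI) (simp add: P_def)
      have "(\<lambda>n. r * (1/2 :: real) ^ n) \<longlonglongrightarrow> r * 0"
        by (intro tendsto_mult tendsto_const LIMSEQ_power_zero) simp
      then show "(\<lambda>n. r * (1/2 :: real) ^ n) \<longlonglongrightarrow> 0"
        by simp
    qed simp_all
    then have "(\<lambda>n. f x - F n x) \<longlonglongrightarrow> f x - 0"
      by (intro tendsto_diff tendsto_const)
    ultimately show ?thesis
      using LIMSEQ_unique by fastforce
  qed
  ultimately show ?thesis
    by blast
qed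

text \<open>
  A path of least cardinality from \<open>b\<close> to \<open>x\<close> has at most \<open>L\<close> points; the two further places are for the
  endpoints, which \<open>path_pattern\<close> lists twice.
\<close>
lemma reach_boundary:
  fixes X :: "'n::finite \<Rightarrow> 'a::metric_space set" and S :: "('a ^ 'n) set"
  assumes b: "\<And>i. b i \<in> B \<inter> X i" and F: "F = full_set_assoc X S B b"
    and rel: "\<And>x y. x \<in> F \<Longrightarrow> y \<in> F \<Longrightarrow> related F x y"
    and L: "\<And>x y P. x \<in> F \<Longrightarrow> y \<in> F \<Longrightarrow> geodesic F x y P \<Longrightarrow> card P \<le> L"
  shows "S \<subseteq> reach X S b (L + 2) B"
proof
  let ?b = "\<chi> j. b j" and ?N = "L + 2"
  fix x assume "x \<in> S"
  then have xF: "x \<in> F"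
    by (simp add: F full_set_assoc_def)
  have "?b \<in> {x. x $ i \<in> B \<inter> X i \<and> (\<forall>j. j \<noteq> i \<longrightarrow> x $ j = b j)}" for i
    using b[of i] by simp
  then have bF: "?b \<in> F"
    unfolding F full_set_assoc_def by blast
  obtain P0 where "is_path F ?b x P0"
    using rel[OF bF xF] by (auto simp: related_def)
  then obtain P where P: "is_path F ?b x P" "\<And>Q. is_path F ?b x Q \<Longrightarrow> card P \<le> card Q"
    using ex_has_least_nat[of "is_path F ?b x" P0 card] by blast
  then have "card P \<le> L"
    using L[OF bF xF, of P] by (simp add: geodesic_def)
  then have card: "card P + 2 \<le> ?N"
    by simp
  have P': "finite P" "full P" "x \<in> P" "?b \<in> P" "P \<subseteq> F"
    using P(1) by (simp_all add: is_path_def)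
  obtain p e where p: "range p \<subseteq> P" "p 0 = ?b" "p 1 = x" "\<And>k. ?N \<le> k \<Longrightarrow> p k = ?b"
    and e: "e \<in> patterns ?N" "\<And>j k. p (e j k) $ j = p k $ j" "\<And>i. \<exists>c. determines ?N e i c"
    by (rule path_pattern[OF P'(1,2) card P'(3,4)]) (rule that, assumption+)
  have "\<exists>l. p k \<in> piece X S b B l" for k
  proof -
    have "p k \<in> F"
      using p(1) P'(5) by blast
    then consider "p k \<in> S" | i where "p k $ i \<in> B \<inter> X i" "\<And>j. j \<noteq> i \<Longrightarrow> p k $ j = b j"
      unfolding F full_set_assoc_def by blast
    then show ?thesis
    proof cases
      case 1
      then have "p k \<in> piece X S b B None"
        by (simp add: piece_def)
      then show ?thesis ..
    next
      case (2 i)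
      then have "p k \<in> piece X S b B (Some i)"
        by (simp add: piece_def)
      then show ?thesis ..
    qed
  qed
  then have "\<forall>k. \<exists>l. p k \<in> piece X S b B l"
    by blast
  from choice[OF this] obtain l where l: "\<forall>k. p k \<in> piece X S b B (l k)" ..
  define \<sigma> where "\<sigma> k = (if k < ?N then l k else None)" for k
  have "\<sigma> \<in> labels ?N"
    by (simp add: labels_def \<sigma>_def)
  then have "(e, \<sigma>) \<in> path_types ?N"
    using e(1,3) by (simp add: path_types_def)
  moreover have "p \<in> conf X S b ?N B (e, \<sigma>)"
    using p e(2) l \<open>x \<in> S\<close> by (simp add: conf_def \<sigma>_def)
  ultimately show "x \<in> reach X S b ?N B"
    unfolding reach_def using p(3) by (intro image_eqI[of x _ p]) auto
qed

section \<open>The spaces of continuous functions\<close>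

lemma C_iff:
  assumes "compact Y"
  shows "f \<in> C Y \<longleftrightarrow> f \<in> extensional Y \<and> continuous_on Y f"
proof -
  have "compactin (top_of_set Y) (topspace (top_of_set Y))"
    using assms by (simp add: compactin_subtopology)
  then show ?thesis
    by (subst compactin_mspace_cfunspace) simp_all
qed

theorem mainTheorem2:
  fixes X :: "'n::finite \<Rightarrow> 'a::metric_space set"
    and S F :: "('a ^ 'n) set"
    and B :: "'a set"
  assumes "CARD('n) \<ge> 2"
    and "\<And>i. compact (X i)"
    and "disjoint_family X"
    and "S \<subseteq> Omega X"
    and "compact S"
    and "good S"
    and "\<not> full S"
    and "\<And>i. Proj i S = X i"
    and "boundary_of S B"
    and "borel_in X B"
    and "\<And>i. B \<inter> X i \<noteq> {}"
    and "is_full_set_assoc X S B F"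
    and "\<And>x y. x \<in> F \<Longrightarrow> y \<in> F \<Longrightarrow> related F x y"
    and "\<exists>L. \<forall>x\<in>F. \<forall>y\<in>F. \<forall>P. geodesic F x y P \<longrightarrow> card P \<le> L"
  shows "mtopology_of (C_metric S) closure_of (C_sum X S) = C S \<and> C_sum X S = C S"
proof -
  note X = assms(2) and S = assms(5)
  have SX: "x $ i \<in> X i" if "x \<in> S" for x i
    using assms(4) that by (auto simp: Omega_def)
  have "S \<noteq> {}"
    using assms(8,11) by (fastforce simp: Proj_def)
  obtain b where b: "\<And>i. b i \<in> B \<inter> X i" and F: "F = full_set_assoc X S B b"
    using assms(12) unfolding is_full_set_assoc_def by blast
  obtain L where L: "\<And>x y P. x \<in> F \<Longrightarrow> y \<in> F \<Longrightarrow> geodesic F x y P \<Longrightarrow> card P \<le> L"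
    using assms(14) by blast
  have reach: "S \<subseteq> reach X S b (L + 2) B"
    by (rule reach_boundary[OF b F assms(13) L])
  have BX: "B \<subseteq> (\<Union>i. X i)"
    using assms(8,9) by (simp add: boundary_of_def)
  have X_compact: "compact (\<Union>i. X i)"
    using X by (intro compact_UN) auto
  have "B \<inter> X i \<in> sets borel" for i
  proof -
    have "B \<inter> X i \<in> (\<inter>) (X i) ` sets borel"
      using assms(10) by (simp add: borel_in_def sets_restrict_space)
    then obtain A where "B \<inter> X i = X i \<inter> A" "A \<in> sets borel"
      by blast
    moreover have "X i \<in> sets borel"
      using compact_imp_closed[OF X] by (rule borel_closed)
    ultimately show ?thesis
      by simp
  qed
  then have "(\<Union>i. B \<inter> X i) \<in> sets borel"
    by (intro sets.finite_UN) auto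
  moreover have "(\<Union>i. B \<inter> X i) = B"
    using BX by blast
  ultimately have B: "B \<in> sets borel"
    by simp
  have "\<exists>v. (\<forall>i. continuous_on (X i) (v i)) \<and> (\<forall>x\<in>S. f x = (\<Sum>i\<in>UNIV. v i (x $ i)))"
    if f: "continuous_on S f" for f :: "'a ^ 'n \<Rightarrow> complex"
  proof -
    obtain r0 where r0: "\<And>x. x \<in> S \<Longrightarrow> norm (f x) \<le> r0"
      using compact_imp_bounded[OF compact_continuous_image[OF f S]] by (auto simp: bounded_iff)
    show ?thesis
    proof (rule exact_of_approximate_sums[OF SX _ f])
      show "norm (f x) \<le> max r0 1" if "x \<in> S" for x
        using r0[OF that] by simp
      fix h :: "'a ^ 'n \<Rightarrow> complex" and r :: real
      assume h: "continuous_on S h" "\<And>x. x \<in> S \<Longrightarrow> norm (h x) \<le> r" "0 < r"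
      have "\<exists>u. solves S h u \<and> (\<forall>i. \<forall>a \<in> B \<inter> Proj i S. u i a = 0)"
        using assms(9)[unfolded boundary_of_def, THEN conjunct2, THEN spec[of _ "\<lambda>a. 0"], THEN spec[of _ h], THEN conjunct1] .
      then obtain u where u: "solves S h u" "\<And>i a. a \<in> B \<inter> X i \<Longrightarrow> u i a = 0"
        unfolding assms(8) by blast
      have "0 \<le> r" "0 < r / 2"
        using h(3) by simp_all
      from approximation_by_continuous_sums[OF S \<open>S \<noteq> {}\<close> SX X B BX X_compact b u reach h(1,2) this]
      obtain g where g: "\<And>i. continuous_on (X i) (g i)"
        "\<And>i a. a \<in> X i \<Longrightarrow> norm (g i a) \<le> 2 * (coef_bound (L + 2) i * r)"
        "\<And>x. x \<in> S \<Longrightarrow> norm (h x - (\<Sum>i\<in>UNIV. g i (x $ i))) < r / 2"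
        by blast
      show "\<exists>g. (\<forall>i. continuous_on (X i) (g i)) \<and> (\<forall>i. \<forall>a\<in>X i. norm (g i a) \<le> (2 * coef_bound (L + 2) i) * r) \<and>
         (\<forall>x\<in>S. norm (h x - (\<Sum>i\<in>UNIV. g i (x $ i))) \<le> r / 2)"
        using g by (intro exI[of _ g]) (simp add: mult.assoc less_imp_le)
    qed simp_all
  qed
  then have rep: "\<exists>v. (\<forall>i. continuous_on (X i) (v i)) \<and> (\<forall>x\<in>S. f x = (\<Sum>i\<in>UNIV. v i (x $ i)))"
    if "continuous_on S f" for f :: "'a ^ 'n \<Rightarrow> complex"
    using that by blast
  have "C_sum X S = C S"
  proof (intro set_eqI iffI)
    fix f assume "f \<in> C_sum X S"
    then obtain u where u: "\<And>i. u i \<in> C (X i)" and f: "f = restrict (\<lambda>x. \<Sum>i\<in>UNIV. u i (x $ i)) S"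
      unfolding C_sum_def by blast
    have "continuous_on S (\<lambda>x. \<Sum>i\<in>UNIV. u i (x $ i))"
      using u SX unfolding C_iff[OF X] by (intro sum_coordinates_continuous[of X]) blast+
    then show "f \<in> C S"
      unfolding C_iff[OF S] f by (simp cong: continuous_on_cong)
  next
    fix f assume "f \<in> C S"
    then have f: "f \<in> extensional S" "continuous_on S f"
      by (simp_all add: C_iff[OF S] del: mspace_cfunspace)
    then obtain v where v: "\<And>i. continuous_on (X i) (v i)" "\<And>x. x \<in> S \<Longrightarrow> f x = (\<Sum>i\<in>UNIV. v i (x $ i))"
      using rep by blast
    let ?u = "\<lambda>i. restrict (v i) (X i)"
    have "?u i \<in> C (X i)" for i
      unfolding C_iff[OF X] using v(1)[of i] by (simp cong: continuous_on_cong)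
    moreover have "f = restrict (\<lambda>x. \<Sum>i\<in>UNIV. ?u i (x $ i)) S"
    proof
      fix x
      show "f x = restrict (\<lambda>x. \<Sum>i\<in>UNIV. ?u i (x $ i)) S x"
      proof (cases "x \<in> S")
        case True
        then show ?thesis
          using v(2)[OF True] SX[OF True] by simp
      next
        case False
        then show ?thesis
          using f(1) by (simp add: extensional_def)
      qed
    qed
    ultimately show "f \<in> C_sum X S"
      unfolding C_sum_def by (intro CollectI exI[of _ ?u] conjI allI)
  qed
  moreover have "mtopology_of (C_metric S) closure_of C S = C S"
    using closure_of_topspace[of "mtopology_of (C_metric S)"] by (simp only: topspace_mtopology_of)
  ultimately show ?thesis
    by simp
qed

end
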